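(* Let $T$ be an arbitrary $3$-point metric space all of whose triangle inequalities are strict. Then there exists $\varepsilon>0$ such that for any nonempty finite subset $M$ of the neighborhood $U_\varepsilon(T)\subset\mathcal{M}_3$, each Steiner minimal tree $G\in\operatorname{SMT}(M,\mathcal{M})$ is a minimal filling of $M$.
   Context: $\mathcal{M}$ is the Gromov--Hausdorff space: the set of isometry classes of nonempty compact metric spaces with the Gromov--Hausdorff metric $d_{GH}$. $\mathcal{M}_n\subset\mathcal{M}$ is the subspace of (isometry classes of) metric spaces containing at most $n$ points, with the induced metric, and $U_\varepsilon(T)=\{X\in\mathcal{M}_3: d_{GH}(X,T)<\varepsilon\}$. Let $X$ be a metric space and $|xy|$ the distance between its points. A (finite) graph $G=(V,E)$ is defined on $X$ if $V\subset X$; the length of an edge $vw$ is $|vw|$, and the length $|G|$ of $G$ is the sum of the lengths of its edges. For a finite $M\subset X$, $G$ connects $M$ if $M\subset V$. The number $\operatorname{smt}(M,X)$ is the infimum of the lengths of connected graphs on $X$ that connect $M$. A Steiner minimal tree (shortest tree) on $M$ in $X$ is a tree $G$ on $X$ that connects $M$ and satisfies $|G|=\operatorname{smt}(M,X)$; the set of all of these is $\operatorname{SMT}(M,X)$. For a finite metric space $M$, the length of minimal filling $\operatorname{mf}(M)$ is the infimum of those $r$ for which there exist a metric space $X$ and an isometric (distance-preserving) embedding $\mu\colon M\to X$ with $\operatorname{smt}(\mu(M),X)\le r$. A tree $G\in\operatorname{SMT}(M,\mathcal{M})$ is a minimal filling of $M$ (where $M$ carries the metric induced from $\mathcal{M}$)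 if $|G|=\operatorname{mf}(M)$, i.e. $\operatorname{smt}(M,\mathcal{M})=\operatorname{mf}(M)$. *)

theory Defs
  imports "HOL-Analysis.Analysis"
begin

section \<open>Isometries\<close>

definition isometry :: "'a metric \<Rightarrow> 'b metric \<Rightarrow> ('a \<Rightarrow> 'b) \<Rightarrow> bool" where
  "isometry X Y f \<longleftrightarrow> bij_betw f (mspace X) (mspace Y) \<and>
     (\<forall>x\<in>mspace X. \<forall>y\<in>mspace X. mdist Y (f x) (f y) = mdist X x y)"

definition isometric :: "'a metric \<Rightarrow> 'b metric \<Rightarrow> bool" where
  "isometric X Y \<longleftrightarrow> (\<exists>f. isometry X Y f)"

lemma isometric_refl: "isometric X X"
  unfolding isometric_def isometry_def by (rule exI[of _ id]) auto

lemma isometric_sym: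
  assumes "isometric X Y" shows "isometric Y X"
proof -
  obtain f where f: "bij_betw f (mspace X) (mspace Y)"
    "\<And>x y. x \<in> mspace X \<Longrightarrow> y \<in> mspace X \<Longrightarrow> mdist Y (f x) (f y) = mdist X x y"
    using assms unfolding isometric_def isometry_def by blast
  let ?g = "inv_into (mspace X) f"
  have "bij_betw ?g (mspace Y) (mspace X)" using f(1) by (rule bij_betw_inv_into)
  moreover have "mdist X (?g x) (?g y) = mdist Y x y"
    if "x \<in> mspace Y" "y \<in> mspace Y" for x y
    using f(2)[of "?g x" "?g y"] f(1) that
    by (simp add: bij_betw_apply[OF bij_betw_inv_into] bij_betw_inv_into_right[of f])
  ultimately show ?thesis unfolding isometric_def isometry_def by blast
qed

lemma isometric_trans:
  assumes "isometric X Y" "isometric Y Z" shows "isometric X Z"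
proof -
  obtain f g where "isometry X Y f" "isometry Y Z g"
    using assms unfolding isometric_def by blast
  then have "isometry X Z (g \<circ> f)"
    unfolding isometry_def by (metis (no_types, lifting) bij_betw_apply bij_betw_trans comp_apply)
  then show ?thesis unfolding isometric_def by blast
qed

lemma isometric_compact_space:
  assumes "isometric X Y" "compact_space (mtopology_of X)"
  shows "compact_space (mtopology_of Y)"
proof -
  obtain f where f: "bij_betw f (mspace X) (mspace Y)"
    "\<And>x y. x \<in> mspace X \<Longrightarrow> y \<in> mspace X \<Longrightarrow> mdist Y (f x) (f y) = mdist X x y"
    using assms unfolding isometric_def isometry_def by blast
  interpret Metric_space12 "mspace X" "mdist X" "mspace Y" "mdist Y"
    by (simp add: Metric_space12_def)
  have "homeomorphic_map (mtopology_of X) (mtopology_of Y) f"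
    unfolding mtopology_of_def using f
    by (intro isometry_imp_homeomorphic_map) (auto simp: bij_betw_def)
  then show ?thesis
    using assms(2) homeomorphic_compact_space homeomorphic_map_imp_homeomorphic_space by blast
qed

definition metric_image :: "('a \<Rightarrow> 'b) \<Rightarrow> 'a metric \<Rightarrow> 'b metric" where
  "metric_image f X = metric (f ` mspace X,
     \<lambda>u v. mdist X (inv_into (mspace X) f u) (inv_into (mspace X) f v))"

lemma isometry_metric_image:
  assumes "inj_on f (mspace X)"
  shows "isometry X (metric_image f X) f"
proof -
  let ?d = "\<lambda>u v. mdist X (inv_into (mspace X) f u) (inv_into (mspace X) f v)"
  interpret I: Metric_space "f ` mspace X" ?d
  proof
    fix x y z
    show "0 \<le> ?d x y" by simp
    show "?d x y = ?d y x" by (rule mdist_commute)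
    show "(?d x y = 0) = (x = y)" if "x \<in> f ` mspace X" "y \<in> f ` mspace X"
      using that assms by auto
    show "?d x z \<le> ?d x y + ?d y z"
      if "x \<in> f ` mspace X" "y \<in> f ` mspace X" "z \<in> f ` mspace X"
      using that by (intro mdist_triangle) (auto intro: inv_into_into)
  qed
  show ?thesis
    using assms unfolding isometry_def metric_image_def
    by (auto simp: I.mspace_metric I.mdist_metric intro: inj_on_imp_bij_betw)
qed

text \<open>
  Every compact metric space has at most continuum many points, so the compact metric
  spaces with carrier in \<^typ>\<open>real\<close> represent all isometry classes.
\<close>

lemma compact_isometric_real:
  assumes "compact_space (mtopology_of X)"
  shows "\<exists>Y :: real metric. isometric X Y"
proof -
  interpret Metric_space "mspace X" "mdist X" by simp
  have "mtotally_bounded (mspace X)"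
    using assms by (simp add: mtopology_of_def compact_space_eq_mcomplete_mtotally_bounded)
  then have "\<exists>K. finite K \<and> K \<subseteq> mspace X \<and> mspace X \<subseteq> (\<Union>x\<in>K. mball x (1 / real (Suc n)))" for n
    unfolding mtotally_bounded_def by simp
  then obtain K where K: "\<And>n. finite (K n)" "\<And>n. K n \<subseteq> mspace X"
    "\<And>n. mspace X \<subseteq> (\<Union>x\<in>K n. mball x (1 / real (Suc n)))"
    by metis
  define C where "C = (\<Union>n. K n)"
  have C: "countable C" unfolding C_def using K(1) by (simp add: countable_finite)
  define f where "f x = {p. case prod_decode p of (i, n) \<Rightarrow>
      mdist X (from_nat_into C i) x < 1 / real (Suc n)}" for x
  have "inj_on f (mspace X)"
  proof (rule inj_onI, rule ccontr)
    fix x y assume xy: "x \<in> mspace X" "y \<in> mspace X" "f x = f y" "x \<noteq> y"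
    then have "mdist X x y / 2 > 0" by simp
    then obtain n where n: "1 / real (Suc n) < mdist X x y / 2"
      using nat_approx_posE by blast
    obtain c where c: "c \<in> K n" "mdist X c x < 1 / real (Suc n)"
      using K(3)[of n] xy(1) by auto
    have "c \<in> C" using c(1) C_def by blast
    then obtain i where i: "from_nat_into C i = c"
      using C from_nat_into_surj by metis
    have "prod_encode (i, n) \<in> f x" using c(2) i by (simp add: f_def)
    then have "prod_encode (i, n) \<in> f y" using xy(3) by simp
    then have "mdist X c y < 1 / real (Suc n)" using i by (simp add: f_def)
    moreover have "mdist X x y \<le> mdist X c x + mdist X c y"
      using triangle''[of x c y] xy c(1) K(2) by blast
    ultimately show False using n c(2) by linarith
  qed
  moreover obtain g :: "nat set \<Rightarrow> real" where "inj g"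
    using nat_sets_eqpoll_reals eqpoll_imp_lepoll unfolding lepoll_def by blast
  ultimately have "inj_on (g \<circ> f) (mspace X)"
    by (simp add: comp_inj_on inj_on_subset)
  then show ?thesis
    unfolding isometric_def using isometry_metric_image by blast
qed


section \<open>The Gromov--Hausdorff space\<close>

definition metric_nbhd :: "'a metric \<Rightarrow> 'a set \<Rightarrow> real \<Rightarrow> 'a set" where
  "metric_nbhd Z A r = (\<Union>a\<in>A. mball_of Z a r)"

definition hausdorff_dist :: "'a metric \<Rightarrow> 'a set \<Rightarrow> 'a set \<Rightarrow> real" where
  "hausdorff_dist Z A B =
     Inf {r. 0 < r \<and> A \<subseteq> metric_nbhd Z B r \<and> B \<subseteq> metric_nbhd Z A r}"

text \<open>
  The ambient space \<open>Z\<close> may be taken with carrier in \<^typ>\<open>real\<close>: only the union of the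
  two compact copies matters; see \<open>gh_distance_le\<close> below.
\<close>

definition gh_distance :: "'a metric \<Rightarrow> 'b metric \<Rightarrow> real" where
  "gh_distance X Y = Inf {hausdorff_dist Z A B | (Z :: real metric) A B.
     A \<subseteq> mspace Z \<and> B \<subseteq> mspace Z \<and>
     isometric X (submetric Z A) \<and> isometric Y (submetric Z B)}"

lemma gh_distance_cong:
  assumes "isometric X X'" "isometric Y Y'"
  shows "gh_distance X Y = gh_distance X' Y'"
proof -
  have "isometric X W \<longleftrightarrow> isometric X' W" for W :: "real metric"
    by (rule iffI; erule isometric_trans[rotated]; intro isometric_sym[OF assms(1)] assms(1))
  moreover have "isometric Y W \<longleftrightarrow> isometric Y' W" for W :: "real metric"
    by (rule iffI; erule isometric_trans[rotated]; intro isometric_sym[OF assms(2)] assms(2))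
  ultimately show ?thesis unfolding gh_distance_def by simp
qed

lemma hausdorff_dist_nonneg:
  assumes "A \<noteq> {}" "A \<subseteq> mspace Z" "compactin (mtopology_of Z) A"
    "B \<noteq> {}" "B \<subseteq> mspace Z" "compactin (mtopology_of Z) B"
  shows "0 \<le> hausdorff_dist Z A B"
proof -
  interpret Metric_space "mspace Z" "mdist Z" by simp
  have "mbounded (A \<union> B)"
    using assms by (intro compactin_imp_mbounded compactin_Un) (auto simp: mtopology_of_def)
  then obtain r where r: "0 < r" "\<And>x y. x \<in> A \<union> B \<Longrightarrow> y \<in> A \<union> B \<Longrightarrow> mdist Z x y \<le> r"
    unfolding mbounded_alt_pos by blast
  obtain a b where ab: "a \<in> A" "b \<in> B" using assms by blast
  have "x \<in> metric_nbhd Z B (r + 1)" if "x \<in> A" for x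
    using that ab r(2)[of b x] assms unfolding metric_nbhd_def by (intro UN_I[of b]) auto
  moreover have "x \<in> metric_nbhd Z A (r + 1)" if "x \<in> B" for x
    using that ab r(2)[of a x] assms unfolding metric_nbhd_def by (intro UN_I[of a]) auto
  ultimately have "r + 1 \<in> {r. 0 < r \<and> A \<subseteq> metric_nbhd Z B r \<and> B \<subseteq> metric_nbhd Z A r}"
    using r(1) by auto
  then show ?thesis
    unfolding hausdorff_dist_def by (intro cInf_greatest) auto
qed

lemma isometric_compactin_submetric:
  assumes "isometric X (submetric Z A)" "A \<subseteq> mspace Z" "mspace X \<noteq> {}"
    "compact_space (mtopology_of X)"
  shows "A \<noteq> {}" "compactin (mtopology_of Z) A"
proof -
  have "A \<inter> mspace Z = A" using assms(2) by blast
  then show "A \<noteq> {}"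
    using assms(1,3) by (auto simp: isometric_def isometry_def bij_betw_def)
  show "compactin (mtopology_of Z) A"
    using isometric_compact_space[OF assms(1,4)] assms(2)
    by (simp add: compactin_subspace mtopology_of_submetric)
qed

lemma isometric_submetric_image:
  assumes "isometry W V f" "C \<subseteq> mspace W"
  shows "isometric (submetric W C) (submetric V (f ` C))"
proof -
  have "f ` C \<inter> mspace V = f ` C" "C \<inter> mspace W = C"
    using assms by (auto simp: isometry_def bij_betw_def)
  then have "isometry (submetric W C) (submetric V (f ` C)) f"
    using assms unfolding isometry_def
    by (auto simp: bij_betw_def subset_iff intro: inj_on_subset)
  then show ?thesis unfolding isometric_def by blast
qed

lemma metric_nbhd_isometry:
  assumes "isometry W V f" "C \<subseteq> mspace W" "D \<subseteq> mspace W"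
  shows "f ` C \<subseteq> metric_nbhd V (f ` D) r \<longleftrightarrow> C \<subseteq> metric_nbhd W D r"
proof -
  have V: "f x \<in> mspace V" if "x \<in> mspace W" for x
    using assms(1) that by (auto simp: isometry_def bij_betw_def)
  have d: "mdist V (f x) (f y) = mdist W x y" if "x \<in> mspace W" "y \<in> mspace W" for x y
    using assms(1) that by (simp add: isometry_def)
  have "f c \<in> metric_nbhd V (f ` D) r \<longleftrightarrow> c \<in> metric_nbhd W D r" if "c \<in> C" for c
    using that assms(2,3) V d unfolding metric_nbhd_def by (auto simp: subset_iff)
  then show ?thesis by blast
qed

lemma gh_distance_le:
  fixes Z :: "'c metric"
  assumes X: "mspace X \<noteq> {}" "compact_space (mtopology_of X)"
    and Y: "mspace Y \<noteq> {}" "compact_space (mtopology_of Y)"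
    and A: "A \<subseteq> mspace Z" "isometric X (submetric Z A)"
    and B: "B \<subseteq> mspace Z" "isometric Y (submetric Z B)"
  shows "gh_distance X Y \<le> hausdorff_dist Z A B"
proof -
  define W where "W = submetric Z (A \<union> B)"
  have W: "mspace W = A \<union> B" using A B by (auto simp: W_def)
  have "compactin (mtopology_of Z) (A \<union> B)"
    using isometric_compactin_submetric(2)[OF A(2,1) X] isometric_compactin_submetric(2)[OF B(2,1) Y]
    by (rule compactin_Un)
  then have "compact_space (mtopology_of W)"
    by (simp add: W_def compactin_subspace mtopology_of_submetric)
  then obtain V :: "real metric" and f where f: "isometry W V f"
    using compact_isometric_real unfolding isometric_def by blast
  have sub: "submetric W A = submetric Z A" "submetric W B = submetric Z B"
    by (simp_all add: W_def Int_absorb1 Int_commute)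
  have nb: "C \<subseteq> metric_nbhd W D r \<longleftrightarrow> C \<subseteq> metric_nbhd Z D r"
    if "C \<subseteq> A \<union> B" "D \<subseteq> A \<union> B" for C D r
    using that A B unfolding metric_nbhd_def W_def by (auto simp: subset_iff)
  have "hausdorff_dist V (f ` A) (f ` B) = hausdorff_dist Z A B"
    unfolding hausdorff_dist_def
    using metric_nbhd_isometry[OF f, of A B] metric_nbhd_isometry[OF f, of B A] nb W by simp
  moreover have "f ` A \<subseteq> mspace V" "f ` B \<subseteq> mspace V"
    using f W by (auto simp: isometry_def bij_betw_def)
  moreover have "isometric X (submetric V (f ` A))"
    using isometric_trans[OF A(2)] isometric_submetric_image[OF f, of A] W sub by simp
  moreover have "isometric Y (submetric V (f ` B))"
    using isometric_trans[OF B(2)] isometric_submetric_image[OF f, of B] W sub by simp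
  ultimately have mem: "hausdorff_dist Z A B \<in> {hausdorff_dist Z A B | (Z :: real metric) A B.
     A \<subseteq> mspace Z \<and> B \<subseteq> mspace Z \<and>
     isometric X (submetric Z A) \<and> isometric Y (submetric Z B)}"
    unfolding mem_Collect_eq by metis
  show ?thesis
    unfolding gh_distance_def
  proof (rule cInf_lower[OF mem], rule bdd_belowI[of _ 0], clarify)
    fix Z :: "real metric" and A B
    assume *: "A \<subseteq> mspace Z" "B \<subseteq> mspace Z"
      "isometric X (submetric Z A)" "isometric Y (submetric Z B)"
    then show "0 \<le> hausdorff_dist Z A B"
      by (intro hausdorff_dist_nonneg isometric_compactin_submetric[OF *(3,1) X]
        isometric_compactin_submetric[OF *(4,2) Y])
  qed
qed

quotient_type gh_space = "real metric" / partial: "\<lambda>X Y. isometric X Y \<and>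
    mspace X \<noteq> {} \<and> compact_space (mtopology_of X) \<and>
    mspace Y \<noteq> {} \<and> compact_space (mtopology_of Y)"
proof (rule part_equivpI)
  let ?X = "metric ({0 :: real}, dist)"
  have "Metric_space {0 :: real} dist"
    using Met_TC.subspace by blast
  then have "mspace ?X = {0}" by (rule Metric_space.mspace_metric)
  moreover from this have "compact_space (mtopology_of ?X)"
    unfolding compact_space_def by (intro finite_imp_compactin) simp_all
  ultimately show "\<exists>X :: real metric. isometric X X \<and>
      mspace X \<noteq> {} \<and> compact_space (mtopology_of X) \<and>
      mspace X \<noteq> {} \<and> compact_space (mtopology_of X)"
    using isometric_refl by (metis insert_not_empty)
next
  show "symp (\<lambda>X Y :: real metric. isometric X Y \<and>
      mspace X \<noteq> {} \<and> compact_space (mtopology_of X) \<and>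
      mspace Y \<noteq> {} \<and> compact_space (mtopology_of Y))"
    by (rule sympI) (simp add: isometric_sym)
next
  show "transp (\<lambda>X Y :: real metric. isometric X Y \<and>
      mspace X \<noteq> {} \<and> compact_space (mtopology_of X) \<and>
      mspace Y \<noteq> {} \<and> compact_space (mtopology_of Y))"
  proof (rule transpI, goal_cases)
    case (1 X Y Z)
    then show ?case using isometric_trans[of X Y Z] by simp
  qed
qed

lift_definition gh_dist :: "gh_space \<Rightarrow> gh_space \<Rightarrow> real"
  is "gh_distance :: real metric \<Rightarrow> real metric \<Rightarrow> real"
  by (rule gh_distance_cong) simp_all

text \<open>The isometry class of a nonempty compact metric space with carrier in any type.\<close>

definition gh_class :: "'a metric \<Rightarrow> gh_space" where
  "gh_class X = abs_gh_space (SOME Y. isometric X Y)"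

definition gh_points_le :: "nat \<Rightarrow> gh_space set" where
  "gh_points_le n = gh_class ` {X :: real metric. mspace X \<noteq> {} \<and> finite (mspace X) \<and> card (mspace X) \<le> n}"

definition gh_nbhd3 :: "real \<Rightarrow> gh_space \<Rightarrow> gh_space set" where
  "gh_nbhd3 \<epsilon> t = {X \<in> gh_points_le 3. gh_dist X t < \<epsilon>}"

lemma gh_class_eq_iff:
  assumes "mspace X \<noteq> {}" "compact_space (mtopology_of X)"
    and "mspace Y \<noteq> {}" "compact_space (mtopology_of Y)"
  shows "gh_class X = gh_class Y \<longleftrightarrow> isometric X Y"
proof -
  define X' where "X' = (SOME Y :: real metric. isometric X Y)"
  define Y' where "Y' = (SOME Z :: real metric. isometric Y Z)"
  have iso: "isometric X X'" "isometric Y Y'"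
    unfolding X'_def Y'_def
    using someI_ex[OF compact_isometric_real[OF assms(2)]]
      someI_ex[OF compact_isometric_real[OF assms(4)]] .
  have ne: "mspace X' \<noteq> {}" "mspace Y' \<noteq> {}"
    using iso assms(1,3) by (auto simp: isometric_def isometry_def bij_betw_def)
  have "compact_space (mtopology_of X')" "compact_space (mtopology_of Y')"
    using isometric_compact_space[OF iso(1) assms(2)] isometric_compact_space[OF iso(2) assms(4)] .
  then have "gh_class X = gh_class Y \<longleftrightarrow> isometric X' Y'"
    unfolding gh_class_def X'_def[symmetric] Y'_def[symmetric]
    using Quotient3_rel[OF Quotient3_gh_space, of X' Y'] ne
    by (simp add: isometric_refl)
  also have "\<dots> \<longleftrightarrow> isometric X Y"
  proof
    assume "isometric X' Y'"
    then show "isometric X Y"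
      by (rule isometric_trans[OF isometric_trans[OF iso(1)] isometric_sym[OF iso(2)]])
  next
    assume "isometric X Y"
    then show "isometric X' Y'"
      by (rule isometric_trans[OF isometric_trans[OF isometric_sym[OF iso(1)]] iso(2)])
  qed
  finally show ?thesis .
qed

lemma gh_dist_gh_class:
  assumes "mspace X \<noteq> {}" "compact_space (mtopology_of X)"
    and "mspace Y \<noteq> {}" "compact_space (mtopology_of Y)"
  shows "gh_dist (gh_class X) (gh_class Y) = gh_distance X Y"
proof -
  define X' where "X' = (SOME Y :: real metric. isometric X Y)"
  define Y' where "Y' = (SOME Z :: real metric. isometric Y Z)"
  have iso: "isometric X X'" "isometric Y Y'"
    unfolding X'_def Y'_def
    using someI_ex[OF compact_isometric_real[OF assms(2)]]
      someI_ex[OF compact_isometric_real[OF assms(4)]] .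
  have ne: "mspace X' \<noteq> {}" "mspace Y' \<noteq> {}"
    using iso assms(1,3) by (auto simp: isometric_def isometry_def bij_betw_def)
  have "compact_space (mtopology_of X')" "compact_space (mtopology_of Y')"
    using isometric_compact_space[OF iso(1) assms(2)] isometric_compact_space[OF iso(2) assms(4)] .
  then have "gh_dist (gh_class X) (gh_class Y) = gh_distance X' Y'"
    unfolding gh_class_def X'_def[symmetric] Y'_def[symmetric]
    by (intro gh_dist.abs_eq) (auto simp: eq_onp_def ne isometric_refl)
  then show ?thesis using gh_distance_cong[OF iso] by simp
qed


section \<open>Steiner minimal trees and minimal fillings\<close>

text \<open>
  Finite simple graphs are pairs of a vertex set and a set of two-element edges.
\<close>

type_synonym 'a ugraph = "'a set \<times> 'a set set"

definition graph_on :: "'a set \<Rightarrow> 'a ugraph \<Rightarrow> bool" where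
  "graph_on X G \<longleftrightarrow> finite (fst G) \<and> fst G \<subseteq> X \<and>
     snd G \<subseteq> {{v, w} | v w. v \<in> fst G \<and> w \<in> fst G \<and> v \<noteq> w}"

definition graph_connected :: "'a ugraph \<Rightarrow> bool" where
  "graph_connected G \<longleftrightarrow> (\<forall>v\<in>fst G. \<forall>w\<in>fst G. (v, w) \<in> {(x, y). {x, y} \<in> snd G}\<^sup>*)"

definition graph_cycle :: "'a ugraph \<Rightarrow> 'a list \<Rightarrow> bool" where
  "graph_cycle G vs \<longleftrightarrow> 3 \<le> length vs \<and> distinct vs \<and>
     (\<forall>i<length vs. {vs ! i, vs ! (Suc i mod length vs)} \<in> snd G)"

definition graph_tree :: "'a ugraph \<Rightarrow> bool" where
  "graph_tree G \<longleftrightarrow> graph_connected G \<and> (\<nexists>vs. graph_cycle G vs)"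

text \<open>Well defined, as distance functions are symmetric.\<close>

definition edge_length :: "('a \<Rightarrow> 'a \<Rightarrow> real) \<Rightarrow> 'a set \<Rightarrow> real" where
  "edge_length d e = (THE r. \<exists>v w. e = {v, w} \<and> r = d v w)"

definition graph_length :: "('a \<Rightarrow> 'a \<Rightarrow> real) \<Rightarrow> 'a ugraph \<Rightarrow> real" where
  "graph_length d G = (\<Sum>e\<in>snd G. edge_length d e)"

definition smt_length :: "'a set \<Rightarrow> ('a \<Rightarrow> 'a \<Rightarrow> real) \<Rightarrow> 'a set \<Rightarrow> real" where
  "smt_length X d M =
     Inf {graph_length d G | G. graph_on X G \<and> graph_connected G \<and> M \<subseteq> fst G}"

definition steiner_minimal_trees :: "'a set \<Rightarrow> ('a \<Rightarrow> 'a \<Rightarrow> real) \<Rightarrow> 'a set \<Rightarrow> 'a ugraph set" where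
  "steiner_minimal_trees X d M =
     {G. graph_on X G \<and> graph_tree G \<and> M \<subseteq> fst G \<and> graph_length d G = smt_length X d M}"

definition isometric_embedding :: "'a set \<Rightarrow> ('a \<Rightarrow> 'a \<Rightarrow> real) \<Rightarrow> 'b metric \<Rightarrow> ('a \<Rightarrow> 'b) \<Rightarrow> bool" where
  "isometric_embedding M d X \<mu> \<longleftrightarrow> \<mu> ` M \<subseteq> mspace X \<and> (\<forall>x\<in>M. \<forall>y\<in>M. mdist X (\<mu> x) (\<mu> y) = d x y)"

text \<open>
  The infimum \<open>smt(\<mu>(M), X)\<close> is approximated by graphs living in finite subspaces of \<open>X\<close>,
  so ambient spaces with carrier in \<^typ>\<open>real\<close> suffice; see \<open>mf_length_le\<close> below.
\<close>

definition mf_length :: "'a set \<Rightarrow> ('a \<Rightarrow> 'a \<Rightarrow> real) \<Rightarrow> real" where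
  "mf_length M d = Inf {r. \<exists>(X :: real metric) \<mu>. isometric_embedding M d X \<mu> \<and>
     smt_length (mspace X) (mdist X) (\<mu> ` M) \<le> r}"

definition minimal_filling :: "gh_space set \<Rightarrow> gh_space ugraph \<Rightarrow> bool" where
  "minimal_filling M G \<longleftrightarrow> G \<in> steiner_minimal_trees UNIV gh_dist M \<and>
     graph_length gh_dist G = mf_length M gh_dist"

lemma edge_length_pair:
  assumes "\<And>x y. d x y = d y x"
  shows "edge_length d {v, w} = d v w"
  unfolding edge_length_def using assms by (intro the_equality) (auto simp: doubleton_eq_iff)

lemma graph_length_nonneg:
  assumes "graph_on X G"
  shows "0 \<le> graph_length (mdist m) G"
  unfolding graph_length_def
proof (rule sum_nonneg)
  fix e assume "e \<in> snd G"
  then obtain v w where "e = {v, w}" using assms unfolding graph_on_def by blast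
  then show "0 \<le> edge_length (mdist m) e" by (simp add: edge_length_pair mdist_commute)
qed

lemma rtrancl_image_pair:
  assumes "(v, w) \<in> {(x, y). {x, y} \<in> E}\<^sup>*"
  shows "(f v, f w) \<in> {(x, y). {x, y} \<in> (`) f ` E}\<^sup>*"
  using assms
proof induction
  case (step y z)
  then have "f ` {y, z} \<in> (`) f ` E" by blast
  then show ?case using step.IH by (auto intro: rtrancl_into_rtrancl)
qed simp

lemma graph_image:
  assumes f: "isometry W V f" and G: "graph_on (mspace W) G" "graph_connected G"
  defines "H \<equiv> (f ` fst G, (`) f ` snd G)"
  shows "graph_on (mspace V) H" "graph_connected H"
    "graph_length (mdist V) H = graph_length (mdist W) G"
proof -
  have inj: "inj_on f (mspace W)" and V: "f ` mspace W = mspace V"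
    and d: "\<And>x y. x \<in> mspace W \<Longrightarrow> y \<in> mspace W \<Longrightarrow> mdist V (f x) (f y) = mdist W x y"
    using f by (auto simp: isometry_def bij_betw_def)
  have E: "\<exists>v w. e = {v, w} \<and> v \<in> fst G \<and> w \<in> fst G \<and> v \<noteq> w" if "e \<in> snd G" for e
    using G(1) that unfolding graph_on_def by blast
  have sub: "fst G \<subseteq> mspace W" using G(1) by (simp add: graph_on_def)
  have "\<exists>v w. f ` e = {v, w} \<and> v \<in> f ` fst G \<and> w \<in> f ` fst G \<and> v \<noteq> w" if e: "e \<in> snd G" for e
  proof -
    obtain v w where vw: "e = {v, w}" "v \<in> fst G" "w \<in> fst G" "v \<noteq> w" using E[OF e] by blast
    then have "f v \<noteq> f w" using sub inj by (meson inj_onD subsetD)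
    then show ?thesis using vw by (intro exI[of _ "f v"] exI[of _ "f w"]) auto
  qed
  then show "graph_on (mspace V) H"
    using G(1) V unfolding graph_on_def H_def by auto
  show "graph_connected H"
    unfolding graph_connected_def
  proof (intro ballI)
    fix v' w' assume "v' \<in> fst H" "w' \<in> fst H"
    then obtain v w where vw: "v \<in> fst G" "w \<in> fst G" "v' = f v" "w' = f w"
      by (auto simp: H_def)
    then have "(v, w) \<in> {(x, y). {x, y} \<in> snd G}\<^sup>*"
      using G(2) by (simp add: graph_connected_def)
    from rtrancl_image_pair[OF this, of f]
    show "(v', w') \<in> {(x, y). {x, y} \<in> snd H}\<^sup>*" using vw by (simp add: H_def)
  qed
  have "e \<subseteq> mspace W" if "e \<in> snd G" for e using E[OF that] sub by blast
  then have "inj_on ((`) f) (snd G)"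
    using inj by (intro inj_onI) (metis inj_on_image_eq_iff)
  moreover have "edge_length (mdist V) (f ` e) = edge_length (mdist W) e" if "e \<in> snd G" for e
    using E[OF that] d sub by (auto simp: edge_length_pair mdist_commute subset_iff)
  ultimately show "graph_length (mdist V) H = graph_length (mdist W) G"
    unfolding graph_length_def H_def by (simp add: sum.reindex)
qed

lemma smt_length_le:
  assumes "graph_on (mspace X) G" "graph_connected G" "M \<subseteq> fst G"
  shows "smt_length (mspace X) (mdist X) M \<le> graph_length (mdist X) G"
  unfolding smt_length_def using assms graph_length_nonneg
  by (intro cInf_lower bdd_belowI[of _ 0]) blast+

lemma connected_graph_exists:
  assumes "finite M" "M \<subseteq> X"
  shows "\<exists>G. graph_on X G \<and> graph_connected G \<and> M \<subseteq> fst G"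
proof -
  let ?G = "(M, {{v, w} | v w. v \<in> M \<and> w \<in> M \<and> v \<noteq> w})"
  have "graph_connected ?G"
    unfolding graph_connected_def
  proof (intro ballI)
    fix v w assume "v \<in> fst ?G" "w \<in> fst ?G"
    then show "(v, w) \<in> {(x, y). {x, y} \<in> snd ?G}\<^sup>*"
      by (cases "v = w") (auto intro!: r_into_rtrancl)
  qed
  then show ?thesis
    using assms by (intro exI[of _ ?G]) (simp add: graph_on_def)
qed

lemma smt_length_nonneg:
  assumes "finite M" "M \<subseteq> mspace X"
  shows "0 \<le> smt_length (mspace X) (mdist X) M"
  unfolding smt_length_def
  using connected_graph_exists[OF assms] graph_length_nonneg by (intro cInf_greatest) blast+

lemma mf_length_le:
  fixes X :: "'b metric"
  assumes M: "finite M" and \<mu>: "isometric_embedding M d X \<mu>"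
  shows "mf_length M d \<le> smt_length (mspace X) (mdist X) (\<mu> ` M)"
proof (rule field_le_epsilon)
  fix \<epsilon> :: real assume \<epsilon>: "0 < \<epsilon>"
  let ?S = "{graph_length (mdist X) G | G. graph_on (mspace X) G \<and> graph_connected G \<and> \<mu> ` M \<subseteq> fst G}"
  have \<mu>': "\<mu> ` M \<subseteq> mspace X" "\<And>x y. x \<in> M \<Longrightarrow> y \<in> M \<Longrightarrow> mdist X (\<mu> x) (\<mu> y) = d x y"
    using \<mu> by (auto simp: isometric_embedding_def)
  have "?S \<noteq> {}"
    using connected_graph_exists[of "\<mu> ` M" "mspace X"] \<mu>'(1) M by blast
  then have "\<exists>s\<in>?S. s < Inf ?S + \<epsilon>"
    using \<epsilon> by (intro cInf_lessD) auto
  then obtain G where G: "graph_on (mspace X) G" "graph_connected G" "\<mu> ` M \<subseteq> fst G"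
    and len: "graph_length (mdist X) G < smt_length (mspace X) (mdist X) (\<mu> ` M) + \<epsilon>"
    unfolding smt_length_def by blast
  define W where "W = submetric X (fst G)"
  have W: "mspace W = fst G" "mdist W = mdist X"
    using G(1) by (auto simp: W_def graph_on_def)
  have "finite (fst G)" using G(1) by (simp add: graph_on_def)
  then obtain f :: "'b \<Rightarrow> nat" where "inj_on f (mspace W)"
    using finite_imp_inj_to_nat_seg W by metis
  then have "inj_on (real \<circ> f) (mspace W)" by (simp add: inj_on_def)
  then have iso: "isometry W (metric_image (real \<circ> f) W) (real \<circ> f)"
    by (rule isometry_metric_image)
  define V where "V = metric_image (real \<circ> f) W"
  define H where "H = ((real \<circ> f) ` fst G, (`) (real \<circ> f) ` snd G)"
  have "graph_on (mspace W) G" using G(1) W by (simp add: graph_on_def)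
  note H = graph_image[OF iso this G(2), folded V_def H_def]
  have emb: "isometric_embedding M d V ((real \<circ> f) \<circ> \<mu>)"
    using iso[folded V_def] \<mu>' G(3) W
    by (auto simp: isometric_embedding_def isometry_def bij_betw_def subset_iff image_subset_iff)
  have "smt_length (mspace V) (mdist V) (((real \<circ> f) \<circ> \<mu>) ` M) \<le> graph_length (mdist V) H"
    using G(3) by (intro smt_length_le H) (auto simp: H_def)
  also have "\<dots> \<le> smt_length (mspace X) (mdist X) (\<mu> ` M) + \<epsilon>"
    using H(3) len W by simp
  finally have mem: "smt_length (mspace X) (mdist X) (\<mu> ` M) + \<epsilon> \<in>
     {r. \<exists>(X :: real metric) \<mu>. isometric_embedding M d X \<mu> \<and>
       smt_length (mspace X) (mdist X) (\<mu> ` M) \<le> r}"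
    using emb by blast
  show "mf_length M d \<le> smt_length (mspace X) (mdist X) (\<mu> ` M) + \<epsilon>"
    unfolding mf_length_def
  proof (rule cInf_lower[OF mem], rule bdd_belowI[of _ 0], clarify)
    fix r \<mu> and X :: "real metric"
    assume "isometric_embedding M d X \<mu>" "smt_length (mspace X) (mdist X) (\<mu> ` M) \<le> r"
    then show "0 \<le> r"
      using smt_length_nonneg[of "\<mu> ` M" X] M by (simp add: isometric_embedding_def)
  qed
qed

end

theory Submission
  imports Defs
begin

text \<open>
  Near \<open>T\<close> the space of triangles looks like a piece of three-dimensional space with the
  supremum norm: the increasingly sorted half side lengths embed the neighbourhood of \<open>T\<close>
  isometrically into it, by \<open>infnorm_le_gh_dist_triangle\<close> and \<open>gh_dist_triangle_le\<close>.  The lower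
  bound on the Gromov--Hausdorff distance holds because a correspondence of small distortion
  matches the vertices bijectively (\<open>correspondence_bijection\<close>) and because sorting two triples
  cannot increase their distance (\<open>sorted_sides_matching\<close>).  The upper bound holds for all pairs of triangles, so
  every triple in a small cube about the coordinates of \<open>T\<close> may be sent to the triangle with these
  coordinates, and this map is 1-Lipschitz.  The cube consists of triangles since the triangle
  inequalities of \<open>T\<close> are strict, and the whole space retracts onto it by truncation.

  This yields maps \<open>\<sigma>\<close>, from the neighbourhood of \<open>T\<close> to the normed space, isometric, and \<open>\<tau>\<close>, from
  the normed space to the Gromov--Hausdorff space, 1-Lipschitz, with \<open>\<tau> (\<sigma> p) = p\<close>.  The supremum norm
  is injective: 1-Lipschitz maps into it extend (\<open>lipschitz_extension_infnorm\<close>).  Hence the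
  embedding of \<open>M\<close> extends to any metric space containing \<open>M\<close>, and composing with \<open>\<tau>\<close> carries a
  connected graph there to one in the Gromov--Hausdorff space that is not longer and still
  connects \<open>M\<close>; so a Steiner minimal tree is not longer than any filling.  Conversely, the length of
  a connected graph in the Gromov--Hausdorff space bounds \<open>mf\<close> from above: extending \<open>\<sigma>\<close> over the
  Gromov--Hausdorff space carries it into a metric space that contains a copy of \<open>M\<close>.  Both
  directions form \<open>smt_length_eq_mf_length\<close>.  What enters about the Gromov--Hausdorff distance there is
  that it is a pseudometric, which follows from its description by correspondences.
\<close>


section \<open>Correspondences and the Gromov--Hausdorff distance\<close>

definition correspondence :: "'a metric \<Rightarrow> 'b metric \<Rightarrow> real \<Rightarrow> ('a \<times> 'b) set \<Rightarrow> bool" where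
  "correspondence X Y \<delta> R \<longleftrightarrow> Domain R = mspace X \<and> Range R = mspace Y \<and>
     (\<forall>(x, y)\<in>R. \<forall>(x', y')\<in>R. \<bar>mdist X x x' - mdist Y y y'\<bar> \<le> \<delta>)"

lemma correspondenceD:
  assumes "correspondence X Y \<delta> R" "(x, y) \<in> R" "(x', y') \<in> R"
  shows "\<bar>mdist X x x' - mdist Y y y'\<bar> \<le> \<delta>"
  using assms unfolding correspondence_def by fast

lemma correspondence_mspace:
  assumes "correspondence X Y \<delta> R" "(x, y) \<in> R"
  shows "x \<in> mspace X" "y \<in> mspace Y"
  using assms unfolding correspondence_def by (metis Domain.DomainI Range.intros)+

text \<open>
  The Gromov--Hausdorff distance is half the infimum of the distortions \<open>\<delta>\<close> of
  correspondences, so converses, composites and identities of correspondences give its symmetry,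
  the triangle inequality and its vanishing on the diagonal.
\<close>
lemma correspondence_converse:
  assumes "correspondence X Y \<delta> R"
  shows "correspondence Y X \<delta> (R\<inverse>)"
  using assms unfolding correspondence_def by (fastforce simp: abs_minus_commute)

lemma correspondence_relcomp:
  assumes R: "correspondence X Y \<delta> R" and S: "correspondence Y Z \<epsilon> S"
  shows "correspondence X Z (\<delta> + \<epsilon>) (R O S)"
proof -
  have D: "Domain R = mspace X" "Range R = mspace Y" "Domain S = mspace Y" "Range S = mspace Z"
    using R S by (simp_all add: correspondence_def)
  then have "Range R = Domain S" by simp
  then have "Domain (R O S) = Domain R" "Range (R O S) = Range S" by blast+
  then have "Domain (R O S) = mspace X" "Range (R O S) = mspace Z" using D by simp_all
  moreover have "\<bar>mdist X x x' - mdist Z z z'\<bar> \<le> \<delta> + \<epsilon>"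
    if xz: "(x, z) \<in> R O S" "(x', z') \<in> R O S" for x z x' z'
  proof -
    obtain y y' where "(x, y) \<in> R" "(y, z) \<in> S" "(x', y') \<in> R" "(y', z') \<in> S"
      using xz by blast
    then show ?thesis
      using correspondenceD[OF R, of x y x' y'] correspondenceD[OF S, of y z y' z'] by linarith
  qed
  ultimately show ?thesis unfolding correspondence_def by blast
qed

lemma correspondence_Id: "correspondence X X 0 (Id_on (mspace X))"
  unfolding correspondence_def by auto

lemma mdist_bounded_of_compact:
  assumes "compact_space (mtopology_of X)"
  obtains B where "0 < B" "\<And>x y. x \<in> mspace X \<Longrightarrow> y \<in> mspace X \<Longrightarrow> mdist X x y \<le> B"
proof -
  interpret Metric_space "mspace X" "mdist X" by simp
  have "mbounded (mspace X)"
    using assms by (intro compactin_imp_mbounded) (auto simp: mtopology_of_def compact_space_def)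
  then show thesis using that unfolding mbounded_alt_pos by blast
qed

lemma correspondence_Times:
  assumes "compact_space (mtopology_of X)" "compact_space (mtopology_of Y)"
    "mspace X \<noteq> {}" "mspace Y \<noteq> {}"
  shows "\<exists>r>0. correspondence X Y (2 * r) (mspace X \<times> mspace Y)"
proof -
  obtain B where B: "0 < B" "\<And>x y. x \<in> mspace X \<Longrightarrow> y \<in> mspace X \<Longrightarrow> mdist X x y \<le> B"
    using mdist_bounded_of_compact[OF assms(1)] by blast
  obtain C where C: "0 < C" "\<And>x y. x \<in> mspace Y \<Longrightarrow> y \<in> mspace Y \<Longrightarrow> mdist Y x y \<le> C"
    using mdist_bounded_of_compact[OF assms(2)] by blast
  have "\<bar>mdist X x x' - mdist Y y y'\<bar> \<le> 2 * (B + C)"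
    if "x \<in> mspace X" "x' \<in> mspace X" "y \<in> mspace Y" "y' \<in> mspace Y" for x x' y y'
    using B(2)[OF that(1,2)] C(2)[OF that(3,4)] B(1) C(1)
      mdist_nonneg[of X x x'] mdist_nonneg[of Y y y']
    unfolding abs_le_iff by argo
  then have "correspondence X Y (2 * (B + C)) (mspace X \<times> mspace Y)"
    using assms(3,4) unfolding correspondence_def by auto
  then show ?thesis using B(1) C(1) by (intro exI[of _ "B + C"]) auto
qed

text \<open>
  The distance between points of different summands is that of a shortest passage through a pair
  of \<open>R\<close>, each passage costing \<open>r\<close>.
\<close>
definition glue_dist :: "'a metric \<Rightarrow> 'b metric \<Rightarrow> real \<Rightarrow> ('a \<times> 'b) set \<Rightarrow> 'a + 'b \<Rightarrow> 'a + 'b \<Rightarrow> real"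
  where
  "glue_dist X Y r R p q =
     (let h = (\<lambda>x y. Inf ((\<lambda>(x', y'). mdist X x x' + mdist Y y' y + r) ` R)) in
      case (p, q) of
        (Inl x, Inl x') \<Rightarrow> mdist X x x'
      | (Inr y, Inr y') \<Rightarrow> mdist Y y y'
      | (Inl x, Inr y) \<Rightarrow> h x y
      | (Inr y, Inl x) \<Rightarrow> h x y)"

lemma glue_metric:
  assumes R: "correspondence X Y (2 * r) R" and r: "0 < r" and ne: "R \<noteq> {}"
  shows "Metric_space (Inl ` mspace X \<union> Inr ` mspace Y) (glue_dist X Y r R)"
proof -
  let ?d = "glue_dist X Y r R"
  let ?S = "\<lambda>x y. (\<lambda>(x', y'). mdist X x x' + mdist Y y' y + r) ` R"
  define h where "h x y = Inf (?S x y)" for x y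
  have d: "?d (Inl x) (Inl x') = mdist X x x'" "?d (Inr y) (Inr y') = mdist Y y y'"
    "?d (Inl x) (Inr y) = h x y" "?d (Inr y) (Inl x) = h x y" for x x' y y'
    by (simp_all add: glue_dist_def h_def)
  note sp = correspondence_mspace[OF R]
  have h_le: "h x y \<le> mdist X x x' + mdist Y y' y + r" if "(x', y') \<in> R" for x y x' y'
    unfolding h_def
    by (rule cInf_lower) (use that in \<open>auto intro!: bdd_belowI[of _ r]\<close>)
  have h_ge: "c \<le> h x y" if "\<And>x' y'. (x', y') \<in> R \<Longrightarrow> c \<le> mdist X x x' + mdist Y y' y + r" for c x y
    unfolding h_def using ne that by (intro cInf_greatest) auto
  have h_pos: "r \<le> h x y" for x y by (rule h_ge) simp
  have t1: "h x y \<le> mdist X x z + h z y" if "x \<in> mspace X" "z \<in> mspace X" for x y z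
  proof -
    have "h x y - mdist X x z \<le> h z y"
    proof (rule h_ge)
      fix x' y' assume "(x', y') \<in> R"
      then show "h x y - mdist X x z \<le> mdist X z x' + mdist Y y' y + r"
        using h_le[of x' y' x y] mdist_triangle[of x X z x'] sp that by fastforce
    qed
    then show ?thesis by simp
  qed
  have t2: "h x y \<le> h x z + mdist Y z y" if "y \<in> mspace Y" "z \<in> mspace Y" for x y z
  proof -
    have "h x y - mdist Y z y \<le> h x z"
    proof (rule h_ge)
      fix x' y' assume "(x', y') \<in> R"
      then show "h x y - mdist Y z y \<le> mdist X x x' + mdist Y y' z + r"
        using h_le[of x' y' x y] mdist_triangle[of y' Y z y] sp that by fastforce
    qed
    then show ?thesis by simp
  qed
  \<comment> \<open>Crossing to the other space and back costs 2r, which pays for the distortion.\<close>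
  have t3: "mdist X x x' \<le> h x y + h x' y" if "x \<in> mspace X" "x' \<in> mspace X" "y \<in> mspace Y" for x x' y
  proof -
    have "mdist X x x' - h x' y \<le> h x y"
    proof (rule h_ge)
      fix a b assume ab: "(a, b) \<in> R"
      have "mdist X x x' - (mdist X x a + mdist Y b y + r) \<le> h x' y"
      proof (rule h_ge)
        fix a' b' assume ab': "(a', b') \<in> R"
        have "mdist X x x' \<le> mdist X x a + mdist X a a' + mdist X a' x'"
          using mdist_triangle[of x X a x'] mdist_triangle[of a X a' x'] sp[OF ab] sp[OF ab'] that
          by linarith
        moreover have "mdist Y b b' \<le> mdist Y b y + mdist Y y b'"
          using mdist_triangle[of b Y y b'] sp[OF ab] sp[OF ab'] that by linarith
        ultimately show "mdist X x x' - (mdist X x a + mdist Y b y + r) \<le> mdist X x' a' + mdist Y b' y + r"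
          using correspondenceD[OF R ab ab'] by (simp add: mdist_commute)
      qed
      then show "mdist X x x' - h x' y \<le> mdist X x a + mdist Y b y + r" by simp
    qed
    then show ?thesis by simp
  qed
  have t4: "mdist Y y y' \<le> h x y + h x y'" if "y \<in> mspace Y" "y' \<in> mspace Y" "x \<in> mspace X" for x y y'
  proof -
    have "mdist Y y y' - h x y' \<le> h x y"
    proof (rule h_ge)
      fix a b assume ab: "(a, b) \<in> R"
      have "mdist Y y y' - (mdist X x a + mdist Y b y + r) \<le> h x y'"
      proof (rule h_ge)
        fix a' b' assume ab': "(a', b') \<in> R"
        have "mdist Y y y' \<le> mdist Y y b + mdist Y b b' + mdist Y b' y'"
          using mdist_triangle[of y Y b y'] mdist_triangle[of b Y b' y'] sp[OF ab] sp[OF ab'] that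
          by linarith
        moreover have "mdist X a a' \<le> mdist X a x + mdist X x a'"
          using mdist_triangle[of a X x a'] sp[OF ab] sp[OF ab'] that by linarith
        ultimately show "mdist Y y y' - (mdist X x a + mdist Y b y + r) \<le> mdist X x a' + mdist Y b' y' + r"
          using correspondenceD[OF R ab ab'] by (simp add: mdist_commute)
      qed
      then show "mdist Y y y' - h x y' \<le> mdist X x a + mdist Y b y + r" by simp
    qed
    then show ?thesis by simp
  qed
  show ?thesis
  proof
    fix p q s
    have h0: "0 < h x y" for x y using h_pos[of x y] r by linarith
    show "0 \<le> ?d p q"
      by (cases p; cases q) (simp_all add: d less_imp_le[OF h0])
    show "?d p q = ?d q p"
      by (cases p; cases q) (simp_all add: d mdist_commute)
    show "(?d p q = 0) = (p = q)"
      if "p \<in> Inl ` mspace X \<union> Inr ` mspace Y" "q \<in> Inl ` mspace X \<union> Inr ` mspace Y"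
      using that h0 by (auto simp: d less_le)
    show "?d p s \<le> ?d p q + ?d q s"
      if "p \<in> Inl ` mspace X \<union> Inr ` mspace Y" "q \<in> Inl ` mspace X \<union> Inr ` mspace Y"
        "s \<in> Inl ` mspace X \<union> Inr ` mspace Y"
      using that
      by (elim UnE imageE)
        (auto simp: d mdist_triangle t2 t3 t4 t1 mdist_commute[of X] mdist_commute[of Y]
          intro: order_trans[OF t1] order_trans[OF t2])
  qed
qed

lemma correspondence_nonempty:
  assumes "correspondence X Y \<delta> R" "mspace X \<noteq> {}"
  shows "R \<noteq> {}"
  using assms unfolding correspondence_def by auto

text \<open>
  The infimum defining the Hausdorff distance is over a nonempty set, because compact sets are
  bounded; only then does a bound on the infimum yield a witness.
\<close>
lemma hausdorff_dist_lessE: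
  assumes A: "A \<noteq> {}" "A \<subseteq> mspace Z" "compactin (mtopology_of Z) A"
    and B: "B \<noteq> {}" "B \<subseteq> mspace Z" "compactin (mtopology_of Z) B"
    and less: "hausdorff_dist Z A B < r"
  obtains s where "s < r" "A \<subseteq> metric_nbhd Z B s" "B \<subseteq> metric_nbhd Z A s"
proof -
  let ?S = "{r. 0 < r \<and> A \<subseteq> metric_nbhd Z B r \<and> B \<subseteq> metric_nbhd Z A r}"
  interpret Metric_space "mspace Z" "mdist Z" by simp
  have "mbounded (A \<union> B)"
    using A B by (intro compactin_imp_mbounded compactin_Un) (auto simp: mtopology_of_def)
  then obtain b where b: "0 < b" "\<And>x y. x \<in> A \<union> B \<Longrightarrow> y \<in> A \<union> B \<Longrightarrow> mdist Z x y \<le> b"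
    unfolding mbounded_alt_pos by blast
  have nb: "C \<subseteq> metric_nbhd Z D (b + 1)" if CD: "C \<subseteq> A \<union> B" "D \<subseteq> A \<union> B" "D \<noteq> {}" for C D
  proof
    fix c assume c: "c \<in> C"
    obtain a where a: "a \<in> D" using CD by blast
    then have "mdist Z a c \<le> b" "a \<in> mspace Z" "c \<in> mspace Z"
      using c CD b(2)[of a c] A B by auto
    then show "c \<in> metric_nbhd Z D (b + 1)"
      using a unfolding metric_nbhd_def by (intro UN_I[of a]) auto
  qed
  have "b + 1 \<in> ?S" using b(1) A(1) B(1) nb by auto
  then obtain s where "s \<in> ?S" "s < r"
    using cInf_lessD[of ?S r] less unfolding hausdorff_dist_def by blast
  then show thesis using that by blast
qed

definition glue_space :: "'a metric \<Rightarrow> 'b metric \<Rightarrow> real \<Rightarrow> ('a \<times> 'b) set \<Rightarrow> ('a + 'b) metric" where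
  "glue_space X Y r R = metric (Inl ` mspace X \<union> Inr ` mspace Y, glue_dist X Y r R)"

lemma glue_space:
  assumes R: "correspondence X Y (2 * r) R" and r: "0 < r" and ne: "mspace X \<noteq> {}"
  shows "mspace (glue_space X Y r R) = Inl ` mspace X \<union> Inr ` mspace Y"
    and "isometric X (submetric (glue_space X Y r R) (Inl ` mspace X))"
    and "isometric Y (submetric (glue_space X Y r R) (Inr ` mspace Y))"
    and "hausdorff_dist (glue_space X Y r R) (Inl ` mspace X) (Inr ` mspace Y) \<le> r"
proof -
  let ?Z = "glue_space X Y r R"
  interpret Metric_space "Inl ` mspace X \<union> Inr ` mspace Y" "glue_dist X Y r R"
    by (rule glue_metric[OF R r correspondence_nonempty[OF R ne]])
  show sp: "mspace ?Z = Inl ` mspace X \<union> Inr ` mspace Y"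
    by (simp add: glue_space_def mspace_metric)
  have d: "mdist ?Z = glue_dist X Y r R"
    by (simp add: glue_space_def mdist_metric)
  have "isometry X (submetric ?Z (Inl ` mspace X)) Inl"
    by (auto simp: isometry_def d sp glue_dist_def intro!: inj_on_imp_bij_betw bij_betw_imageI)
  then show "isometric X (submetric ?Z (Inl ` mspace X))"
    unfolding isometric_def by blast
  have "isometry Y (submetric ?Z (Inr ` mspace Y)) Inr"
    by (auto simp: isometry_def d sp glue_dist_def intro!: inj_on_imp_bij_betw bij_betw_imageI)
  then show "isometric Y (submetric ?Z (Inr ` mspace Y))"
    unfolding isometric_def by blast
  have le: "mdist ?Z (Inl x) (Inr y) \<le> r" if "(x, y) \<in> R" for x y
  proof -
    have "mdist ?Z (Inl x) (Inr y) = Inf ((\<lambda>(x', y'). mdist X x x' + mdist Y y' y + r) ` R)"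
      by (simp add: d glue_dist_def)
    also have "\<dots> \<le> mdist X x x + mdist Y y y + r"
      by (rule cInf_lower) (use that in \<open>force intro!: bdd_belowI[of _ r]\<close>)+
    moreover have "mdist X x x = 0" "mdist Y y y = 0"
      using correspondence_mspace[OF R that] by simp_all
    ultimately show ?thesis by linarith
  qed
  show "hausdorff_dist ?Z (Inl ` mspace X) (Inr ` mspace Y) \<le> r"
  proof (rule field_le_epsilon)
    fix e :: real assume e: "0 < e"
    let ?S = "{s. 0 < s \<and> Inl ` mspace X \<subseteq> metric_nbhd ?Z (Inr ` mspace Y) s \<and>
      Inr ` mspace Y \<subseteq> metric_nbhd ?Z (Inl ` mspace X) s}"
    have D: "Domain R = mspace X" "Range R = mspace Y"
      using R by (simp_all add: correspondence_def)
    have near: "Inl x \<in> mball_of ?Z (Inr y) (r + e)" "Inr y \<in> mball_of ?Z (Inl x) (r + e)"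
      if "(x, y) \<in> R" for x y
    proof -
      have xy: "Inl x \<in> mspace ?Z" "Inr y \<in> mspace ?Z"
        unfolding sp using correspondence_mspace[OF R that] by blast+
      have "mdist ?Z (Inl x) (Inr y) < r + e" using le[OF that] e by linarith
      moreover from this have "mdist ?Z (Inr y) (Inl x) < r + e" by (subst mdist_commute)
      ultimately show "Inl x \<in> mball_of ?Z (Inr y) (r + e)" "Inr y \<in> mball_of ?Z (Inl x) (r + e)"
        unfolding in_mball_of using xy by blast+
    qed
    have "Inl x \<in> metric_nbhd ?Z (Inr ` mspace Y) (r + e)" if "x \<in> mspace X" for x
    proof -
      have "x \<in> Domain R" using D(1) that by simp
      then obtain y where y: "(x, y) \<in> R" by blast
      show ?thesis
        unfolding metric_nbhd_def
      proof (rule UN_I)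
        show "Inr y \<in> Inr ` mspace Y" using correspondence_mspace(2)[OF R y] by simp
        show "Inl x \<in> mball_of ?Z (Inr y) (r + e)" by (rule near(1)[OF y])
      qed
    qed
    moreover have "Inr y \<in> metric_nbhd ?Z (Inl ` mspace X) (r + e)" if "y \<in> mspace Y" for y
    proof -
      have "y \<in> Range R" using D(2) that by simp
      then obtain x where x: "(x, y) \<in> R" by blast
      show ?thesis
        unfolding metric_nbhd_def
      proof (rule UN_I)
        show "Inl x \<in> Inl ` mspace X" using correspondence_mspace(1)[OF R x] by simp
        show "Inr y \<in> mball_of ?Z (Inl x) (r + e)" by (rule near(2)[OF x])
      qed
    qed
    ultimately have "r + e \<in> ?S" using r e by auto
    then show "hausdorff_dist ?Z (Inl ` mspace X) (Inr ` mspace Y) \<le> r + e"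
      unfolding hausdorff_dist_def by (rule cInf_lower) (auto intro: bdd_belowI[of _ 0])
  qed
qed

lemma gh_distance_le_correspondence:
  assumes X: "mspace X \<noteq> {}" "compact_space (mtopology_of X)"
    and Y: "mspace Y \<noteq> {}" "compact_space (mtopology_of Y)"
    and R: "correspondence X Y (2 * r) R" and r: "0 \<le> r"
  shows "gh_distance X Y \<le> r"
proof (rule field_le_epsilon)
  fix e :: real assume e: "0 < e"
  have R': "correspondence X Y (2 * (r + e)) R"
    using R e unfolding correspondence_def by fastforce
  have re: "0 < r + e" using r e by simp
  note Z = glue_space[OF R' re X(1)]
  show "gh_distance X Y \<le> r + e"
    using gh_distance_le[OF X Y _ Z(2) _ Z(3)] Z(1,4) by auto
qed

text \<open>
  Without a common ambient space the infimum in the definition of the Gromov--Hausdorff distance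
  would run over the empty set.  The product relation is a correspondence of finite distortion
  between bounded spaces, so gluing supplies an ambient space, which is then moved into the reals.
\<close>
lemma gh_realization_exists:
  assumes X: "mspace X \<noteq> {}" "compact_space (mtopology_of X)"
    and Y: "mspace Y \<noteq> {}" "compact_space (mtopology_of Y)"
  shows "\<exists>(Z :: real metric) A B. A \<subseteq> mspace Z \<and> B \<subseteq> mspace Z \<and>
     isometric X (submetric Z A) \<and> isometric Y (submetric Z B)"
proof -
  obtain X' Y' :: "real metric" where iso: "isometric X X'" "isometric Y Y'"
    using compact_isometric_real[OF X(2)] compact_isometric_real[OF Y(2)] by blast
  have ne: "mspace X' \<noteq> {}" "mspace Y' \<noteq> {}"
    using iso X(1) Y(1) by (auto simp: isometric_def isometry_def bij_betw_def)
  obtain r where r: "0 < r" "correspondence X' Y' (2 * r) (mspace X' \<times> mspace Y')"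
    using correspondence_Times[OF isometric_compact_space[OF iso(1) X(2)]
        isometric_compact_space[OF iso(2) Y(2)] ne] by blast
  let ?W = "glue_space X' Y' r (mspace X' \<times> mspace Y')"
  note W = glue_space[OF r(2,1) ne(1)]
  \<comment> \<open>The two summands go to the positive and to the negative reals.\<close>
  define j :: "real + real \<Rightarrow> real" where "j = case_sum exp (\<lambda>y. - exp y)"
  have "j p = j q \<Longrightarrow> p = q" for p q
  proof -
    have "exp a \<noteq> - exp b" "- exp b \<noteq> exp a" for a b :: real
      using exp_gt_zero[of a] exp_gt_zero[of b] by linarith+
    then show "j p = j q \<Longrightarrow> p = q" by (cases p; cases q) (simp_all add: j_def)
  qed
  then have "inj_on j (mspace ?W)" by (auto intro: inj_onI)
  note j = isometry_metric_image[OF this]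
  let ?V = "metric_image j ?W"
  have "isometric X (submetric ?V (j ` Inl ` mspace X'))"
    using isometric_trans[OF isometric_trans[OF iso(1) W(2)] isometric_submetric_image[OF j]] W(1)
    by simp
  moreover have "isometric Y (submetric ?V (j ` Inr ` mspace Y'))"
    using isometric_trans[OF isometric_trans[OF iso(2) W(3)] isometric_submetric_image[OF j]] W(1)
    by simp
  moreover have "j ` Inl ` mspace X' \<subseteq> mspace ?V" "j ` Inr ` mspace Y' \<subseteq> mspace ?V"
    using j W(1) unfolding isometry_def bij_betw_def by auto
  ultimately show ?thesis by blast
qed

text \<open>
  Relate points of the two copies that are close in the ambient space: passing from one copy to
  the other at both ends of a segment changes its length by less than twice the Hausdorff
  distance.
\<close>
lemma correspondence_of_gh_distance_less:
  assumes X: "mspace X \<noteq> {}" "compact_space (mtopology_of X)"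
    and Y: "mspace Y \<noteq> {}" "compact_space (mtopology_of Y)"
    and less: "gh_distance X Y < r"
  shows "\<exists>R. correspondence X Y (2 * r) R"
proof -
  let ?S = "{hausdorff_dist Z A B | (Z :: real metric) A B.
     A \<subseteq> mspace Z \<and> B \<subseteq> mspace Z \<and>
     isometric X (submetric Z A) \<and> isometric Y (submetric Z B)}"
  have "?S \<noteq> {}" using gh_realization_exists[OF X Y] by blast
  then obtain h where "h \<in> ?S" "h < r"
    using cInf_lessD[of ?S r] less unfolding gh_distance_def by blast
  then obtain Z :: "real metric" and A B where Z: "A \<subseteq> mspace Z" "B \<subseteq> mspace Z"
     "isometric X (submetric Z A)" "isometric Y (submetric Z B)" "hausdorff_dist Z A B < r"
    by blast
  obtain s where s: "s < r" "A \<subseteq> metric_nbhd Z B s" "B \<subseteq> metric_nbhd Z A s"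
    using hausdorff_dist_lessE[OF isometric_compactin_submetric(1)[OF Z(3,1) X] Z(1)
        isometric_compactin_submetric(2)[OF Z(3,1) X] isometric_compactin_submetric(1)[OF Z(4,2) Y]
        Z(2) isometric_compactin_submetric(2)[OF Z(4,2) Y] Z(5)] by blast
  obtain f g where fg: "isometry X (submetric Z A) f" "isometry Y (submetric Z B) g"
    using Z(3,4) unfolding isometric_def by blast
  have f: "f ` mspace X = A" "\<And>x x'. x \<in> mspace X \<Longrightarrow> x' \<in> mspace X \<Longrightarrow> mdist Z (f x) (f x') = mdist X x x'"
    and g: "g ` mspace Y = B" "\<And>y y'. y \<in> mspace Y \<Longrightarrow> y' \<in> mspace Y \<Longrightarrow> mdist Z (g y) (g y') = mdist Y y y'"
    using fg Z(1,2) unfolding isometry_def bij_betw_def by auto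
  define R where "R = {(x, y). x \<in> mspace X \<and> y \<in> mspace Y \<and> mdist Z (f x) (g y) < s}"
  have "Domain R = mspace X"
  proof
    show "mspace X \<subseteq> Domain R"
    proof
      fix x assume x: "x \<in> mspace X"
      then have "f x \<in> metric_nbhd Z B s" using f(1) s(2) by blast
      then obtain y where "y \<in> mspace Y" "mdist Z (g y) (f x) < s"
        using g(1) unfolding metric_nbhd_def by auto
      then show "x \<in> Domain R" using x by (auto simp: R_def mdist_commute)
    qed
  qed (auto simp: R_def)
  moreover have "Range R = mspace Y"
  proof
    show "mspace Y \<subseteq> Range R"
    proof
      fix y assume y: "y \<in> mspace Y"
      then have "g y \<in> metric_nbhd Z A s" using g(1) s(3) by blast
      then obtain x where "x \<in> mspace X" "mdist Z (f x) (g y) < s"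
        using f(1) unfolding metric_nbhd_def by auto
      then show "y \<in> Range R" using y by (auto simp: R_def)
    qed
  qed (auto simp: R_def)
  moreover have "\<bar>mdist X x x' - mdist Y y y'\<bar> \<le> 2 * r" if xy: "(x, y) \<in> R" "(x', y') \<in> R" for x y x' y'
  proof -
    have m: "x \<in> mspace X" "x' \<in> mspace X" "y \<in> mspace Y" "y' \<in> mspace Y"
      and lt: "mdist Z (f x) (g y) < s" "mdist Z (f x') (g y') < s"
      using xy by (auto simp: R_def)
    have z: "f x \<in> mspace Z" "f x' \<in> mspace Z" "g y \<in> mspace Z" "g y' \<in> mspace Z"
      using m f(1) g(1) Z(1,2) by auto
    have "mdist Z (f x) (f x') \<le> mdist Z (f x) (g y) + mdist Z (g y) (g y') + mdist Z (f x') (g y')"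
      using mdist_triangle[OF z(1,3,2)] mdist_triangle[OF z(3,4,2)] by (simp add: mdist_commute)
    moreover have "mdist Z (g y) (g y') \<le> mdist Z (f x) (g y) + mdist Z (f x) (f x') + mdist Z (f x') (g y')"
      using mdist_triangle[OF z(3,1,4)] mdist_triangle[OF z(1,2,4)] by (simp add: mdist_commute)
    ultimately show ?thesis
      using lt s(1) f(2)[OF m(1,2)] g(2)[OF m(3,4)] by linarith
  qed
  ultimately show ?thesis unfolding correspondence_def by blast
qed

lemma gh_class_exhaust:
  obtains X :: "real metric" where "p = gh_class X" "mspace X \<noteq> {}" "compact_space (mtopology_of X)"
proof -
  have "\<exists>X :: real metric. p = gh_class X \<and> mspace X \<noteq> {} \<and> compact_space (mtopology_of X)"
  proof (induct p rule: gh_space.abs_induct)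
    case (1 X)
    define Y where "Y = (SOME Y :: real metric. isometric X Y)"
    have Y: "isometric X Y" unfolding Y_def by (rule someI[where P = "isometric X", OF isometric_refl])
    then have "mspace Y \<noteq> {}" "compact_space (mtopology_of Y)"
      using 1 isometric_compact_space by (auto simp: isometric_def isometry_def bij_betw_def)
    then have "abs_gh_space X = abs_gh_space Y"
      using Quotient3_rel[OF Quotient3_gh_space, of X Y] 1 Y by (simp add: isometric_refl)
    then have "abs_gh_space X = gh_class X" by (simp add: gh_class_def Y_def)
    then show ?case using 1 by blast
  qed
  then show thesis using that by blast
qed

lemma correspondence_nonneg:
  assumes "correspondence X Y \<delta> R" "mspace X \<noteq> {}"
  shows "0 \<le> \<delta>"
proof -
  obtain x y where "(x, y) \<in> R" using correspondence_nonempty[OF assms] by auto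
  from correspondenceD[OF assms(1) this this] show ?thesis by linarith
qed

lemma gh_dist_nonneg: "0 \<le> gh_dist p q"
proof (rule ccontr)
  assume neg: "\<not> 0 \<le> gh_dist p q"
  obtain X :: "real metric" where X: "p = gh_class X" "mspace X \<noteq> {}" "compact_space (mtopology_of X)"
    by (rule gh_class_exhaust)
  obtain Y :: "real metric" where Y: "q = gh_class Y" "mspace Y \<noteq> {}" "compact_space (mtopology_of Y)"
    by (rule gh_class_exhaust)
  have "gh_distance X Y < gh_distance X Y / 2" "gh_distance X Y < 0"
    using neg gh_dist_gh_class[OF X(2,3) Y(2,3)] X(1) Y(1) by auto
  then show False
    using correspondence_of_gh_distance_less[OF X(2,3) Y(2,3)] correspondence_nonneg[OF _ X(2)]
    by fastforce
qed

lemma gh_dist_self: "gh_dist p p = 0"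
proof -
  obtain X :: "real metric" where X: "p = gh_class X" "mspace X \<noteq> {}" "compact_space (mtopology_of X)"
    by (rule gh_class_exhaust)
  have "gh_distance X X \<le> 0"
    using correspondence_Id[of X] by (intro gh_distance_le_correspondence X) auto
  then show ?thesis
    using gh_dist_gh_class[OF X(2,3) X(2,3)] gh_dist_nonneg[of p p] X(1) by simp
qed

lemma gh_dist_commute_le: "gh_dist p q \<le> gh_dist q p"
proof (rule dense_ge)
  fix r assume r: "gh_dist q p < r"
  obtain X :: "real metric" where X: "p = gh_class X" "mspace X \<noteq> {}" "compact_space (mtopology_of X)"
    by (rule gh_class_exhaust)
  obtain Y :: "real metric" where Y: "q = gh_class Y" "mspace Y \<noteq> {}" "compact_space (mtopology_of Y)"
    by (rule gh_class_exhaust)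
  have "gh_distance Y X < r"
    using r gh_dist_gh_class[OF Y(2,3) X(2,3)] X(1) Y(1) by simp
  then obtain R where "correspondence Y X (2 * r) R"
    using correspondence_of_gh_distance_less[OF Y(2,3) X(2,3)] by blast
  then have "gh_distance X Y \<le> r"
    using r gh_dist_nonneg[of q p]
    by (intro gh_distance_le_correspondence[OF X(2,3) Y(2,3) correspondence_converse]) auto
  then show "gh_dist p q \<le> r"
    using gh_dist_gh_class[OF X(2,3) Y(2,3)] X(1) Y(1) by simp
qed

lemma gh_dist_commute: "gh_dist p q = gh_dist q p"
  by (rule antisym) (rule gh_dist_commute_le)+

lemma gh_dist_triangle: "gh_dist p s \<le> gh_dist p q + gh_dist q s"
proof (rule field_le_epsilon)
  fix e :: real assume e: "0 < e"
  obtain X :: "real metric" where X: "p = gh_class X" "mspace X \<noteq> {}" "compact_space (mtopology_of X)"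
    by (rule gh_class_exhaust)
  obtain Y :: "real metric" where Y: "q = gh_class Y" "mspace Y \<noteq> {}" "compact_space (mtopology_of Y)"
    by (rule gh_class_exhaust)
  obtain Z :: "real metric" where Z: "s = gh_class Z" "mspace Z \<noteq> {}" "compact_space (mtopology_of Z)"
    by (rule gh_class_exhaust)
  note d = gh_dist_gh_class[OF X(2,3) Y(2,3)] gh_dist_gh_class[OF Y(2,3) Z(2,3)]
    gh_dist_gh_class[OF X(2,3) Z(2,3)]
  obtain R where R: "correspondence X Y (2 * (gh_dist p q + e / 2)) R"
    using correspondence_of_gh_distance_less[OF X(2,3) Y(2,3), of "gh_dist p q + e / 2"] d e X(1) Y(1)
    by auto
  obtain S where S: "correspondence Y Z (2 * (gh_dist q s + e / 2)) S"
    using correspondence_of_gh_distance_less[OF Y(2,3) Z(2,3), of "gh_dist q s + e / 2"] d e Y(1) Z(1)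
    by auto
  have "correspondence X Z (2 * (gh_dist p q + gh_dist q s + e)) (R O S)"
    using correspondence_relcomp[OF R S] by (simp add: algebra_simps)
  then have "gh_distance X Z \<le> gh_dist p q + gh_dist q s + e"
    using gh_dist_nonneg[of p q] gh_dist_nonneg[of q s] e
    by (intro gh_distance_le_correspondence[OF X(2,3) Z(2,3)]) auto
  then show "gh_dist p s \<le> gh_dist p q + gh_dist q s + e"
    using d X(1) Z(1) by simp
qed

text \<open>
  If the distortion is smaller than all distances in \<open>X\<close>, two points of \<open>X\<close> cannot be
  related to the same point of \<open>Y\<close>.  So any selection from the relation is injective, and a
  bijection if \<open>Y\<close> has no more points than \<open>X\<close>.
\<close>
lemma correspondence_bijection:
  assumes R: "correspondence X Y \<delta> R"
    and sep: "\<And>x x'. x \<in> mspace X \<Longrightarrow> x' \<in> mspace X \<Longrightarrow> x \<noteq> x' \<Longrightarrow> \<delta> < mdist X x x'"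
    and fin: "finite (mspace Y)" and card: "card (mspace Y) \<le> card (mspace X)"
  shows "\<exists>f. bij_betw f (mspace X) (mspace Y) \<and>
    (\<forall>x\<in>mspace X. \<forall>x'\<in>mspace X. \<bar>mdist X x x' - mdist Y (f x) (f x')\<bar> \<le> \<delta>)"
proof -
  have "\<forall>x\<in>mspace X. \<exists>y. (x, y) \<in> R"
    using R unfolding correspondence_def by (metis DomainE)
  then obtain f where f: "\<And>x. x \<in> mspace X \<Longrightarrow> (x, f x) \<in> R" by metis
  note D = correspondenceD[OF R f f]
  have maps: "f ` mspace X \<subseteq> mspace Y"
    using correspondence_mspace(2)[OF R f] by blast
  have "inj_on f (mspace X)"
  proof (rule inj_onI, rule ccontr)
    fix x x' assume x: "x \<in> mspace X" "x' \<in> mspace X" "f x = f x'" "x \<noteq> x'"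
    have "mdist Y (f x) (f x') = 0"
      using x(2,3) maps by (simp add: image_subset_iff)
    then show False using D[OF x(1,2)] sep[OF x(1,2,4)] by linarith
  qed
  moreover from this have "f ` mspace X = mspace Y"
    using card_image[of f "mspace X"] card card_mono[OF fin maps]
    by (intro card_subset_eq[OF fin maps]) linarith
  ultimately have "bij_betw f (mspace X) (mspace Y)" by (simp add: bij_betw_def)
  then show ?thesis using D by blast
qed


section \<open>Lipschitz maps, Steiner trees and minimal fillings\<close>

lemma infnorm_le_cart:
  fixes x :: "real^'n"
  shows "infnorm x \<le> b \<longleftrightarrow> (\<forall>k. \<bar>x $ k\<bar> \<le> b)"
proof
  assume "infnorm x \<le> b"
  then show "\<forall>k. \<bar>x $ k\<bar> \<le> b" using component_le_infnorm_cart order_trans by blast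
next
  assume "\<forall>k. \<bar>x $ k\<bar> \<le> b"
  then show "infnorm x \<le> b"
    unfolding infnorm_cart by (intro cSup_least) auto
qed

lemma Metric_space_infnorm: "Metric_space UNIV (\<lambda>x y :: 'a::euclidean_space. infnorm (x - y))"
proof
  fix x y z :: 'a
  show "infnorm (x - y) = infnorm (y - x)" by (rule infnorm_sub)
  show "infnorm (x - z) \<le> infnorm (x - y) + infnorm (y - z)"
    using infnorm_triangle[of "x - y" "y - z"] by simp
qed (simp_all add: infnorm_pos_le infnorm_eq_0)

lemma compact_space_finite:
  assumes "finite (mspace X)"
  shows "compact_space (mtopology_of X)"
  unfolding compact_space_def using assms by (intro finite_imp_compactin) simp_all

text \<open>
  McShane's extension in each coordinate: \<open>x \<mapsto> Min {s i $ k + d x (\<mu> i)}\<close> is the largest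
  1-Lipschitz function with the given values.  The supremum norm turns the coordinatewise bound
  into a 1-Lipschitz map with vector values.  The map \<open>\<mu>\<close> indexes the points at which values are
  prescribed.
\<close>
lemma lipschitz_extension_infnorm:
  fixes d :: "'a \<Rightarrow> 'a \<Rightarrow> real" and s :: "'i \<Rightarrow> real^'n"
  assumes fin: "finite I" "I \<noteq> {}" and \<mu>: "\<And>i. i \<in> I \<Longrightarrow> \<mu> i \<in> X"
    and self: "\<And>x. x \<in> X \<Longrightarrow> d x x = 0"
    and comm: "\<And>x y. d x y = d y x"
    and tri: "\<And>x y z. x \<in> X \<Longrightarrow> y \<in> X \<Longrightarrow> z \<in> X \<Longrightarrow> d x z \<le> d x y + d y z"
    and s: "\<And>i j. i \<in> I \<Longrightarrow> j \<in> I \<Longrightarrow> infnorm (s i - s j) \<le> d (\<mu> i) (\<mu> j)"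
  shows "\<exists>F. (\<forall>x\<in>X. \<forall>y\<in>X. infnorm (F x - F y) \<le> d x y) \<and> (\<forall>i\<in>I. F (\<mu> i) = s i)"
proof -
  define m where "m k x = Min ((\<lambda>i. s i $ k + d x (\<mu> i)) ` I)" for k x
  have m_le: "m k x \<le> s i $ k + d x (\<mu> i)" if "i \<in> I" for k x i
    unfolding m_def using fin that by (intro Min_le) auto
  have m_ge: "c \<le> m k x" if "\<And>i. i \<in> I \<Longrightarrow> c \<le> s i $ k + d x (\<mu> i)" for c k x
    unfolding m_def using fin that by (intro Min.boundedI) auto
  have half: "m k x - d x y \<le> m k y" if "x \<in> X" "y \<in> X" for k x y
  proof (rule m_ge)
    fix i assume i: "i \<in> I"
    show "m k x - d x y \<le> s i $ k + d y (\<mu> i)"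
      using m_le[OF i, of k x] tri[OF that \<mu>[OF i]] by linarith
  qed
  have "infnorm ((\<chi> k. m k x) - (\<chi> k. m k y)) \<le> d x y" if "x \<in> X" "y \<in> X" for x y
    unfolding infnorm_le_cart
  proof
    fix k show "\<bar>((\<chi> k. m k x) - (\<chi> k. m k y)) $ k\<bar> \<le> d x y"
      using half[OF that, of k] half[OF that(2,1), of k] comm[of x y] by simp
  qed
  moreover have "(\<chi> k. m k (\<mu> i)) = s i" if i: "i \<in> I" for i
  proof -
    have "m k (\<mu> i) = s i $ k" for k
    proof (rule antisym)
      show "m k (\<mu> i) \<le> s i $ k" using m_le[OF i, of k "\<mu> i"] self[OF \<mu>[OF i]] by simp
      show "s i $ k \<le> m k (\<mu> i)"
      proof (rule m_ge)
        fix j assume j: "j \<in> I"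
        have "\<bar>(s i - s j) $ k\<bar> \<le> d (\<mu> i) (\<mu> j)"
          using s[OF i j] infnorm_le_cart by blast
        then show "s i $ k \<le> s j $ k + d (\<mu> i) (\<mu> j)" by simp
      qed
    qed
    then show ?thesis by (simp add: vec_eq_iff)
  qed
  ultimately show ?thesis by (intro exI[of _ "\<lambda>x. \<chi> k. m k x"]) blast
qed

lemma graph_on_finite_edges:
  assumes "graph_on X G"
  shows "finite (snd G)"
proof -
  have "snd G \<subseteq> Pow (fst G)" "finite (fst G)" using assms unfolding graph_on_def by auto
  then show ?thesis by (meson finite_Pow_iff finite_subset)
qed

lemma edge_length_nonneg:
  assumes "graph_on X G" "e \<in> snd G" "\<And>x y. d x y = d y x" "\<And>x y. 0 \<le> d x y"
  shows "0 \<le> edge_length d e"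
proof -
  obtain v w where "e = {v, w}" using assms(1,2) unfolding graph_on_def by blast
  then show ?thesis using edge_length_pair[of d v w] assms(3,4) by simp
qed

text \<open>
  Edges whose ends are identified by \<open>f\<close> disappear and edges with the same image merge, which only
  shortens the image graph, since lengths are nonnegative.
\<close>
lemma lipschitz_graph_image:
  fixes d :: "'a \<Rightarrow> 'a \<Rightarrow> real" and d' :: "'b \<Rightarrow> 'b \<Rightarrow> real"
  assumes G: "graph_on X G" "graph_connected G"
    and comm: "\<And>x y. d x y = d y x" "\<And>x y. d' x y = d' y x"
    and nonneg: "\<And>x y. 0 \<le> d x y" "\<And>x y. 0 \<le> d' x y"
    and f: "\<And>x. x \<in> X \<Longrightarrow> f x \<in> Y"
    and lip: "\<And>x y. x \<in> X \<Longrightarrow> y \<in> X \<Longrightarrow> d' (f x) (f y) \<le> d x y"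
  shows "\<exists>H. graph_on Y H \<and> graph_connected H \<and> fst H = f ` fst G \<and>
    graph_length d' H \<le> graph_length d G"
proof -
  define E where "E = {e \<in> snd G. card (f ` e) = 2}"
  define H where "H = (f ` fst G, (`) f ` E)"
  have sub: "fst G \<subseteq> X" and fin: "finite (fst G)" using G(1) by (auto simp: graph_on_def)
  have edge: "\<exists>v w. e = {v, w} \<and> v \<in> fst G \<and> w \<in> fst G \<and> v \<noteq> w" if "e \<in> snd G" for e
    using G(1) that unfolding graph_on_def by blast
  have E_iff: "{v, w} \<in> E \<longleftrightarrow> {v, w} \<in> snd G \<and> f v \<noteq> f w" for v w
    by (auto simp: E_def card_insert_if)
  have onH: "graph_on Y H"
    unfolding graph_on_def
  proof (intro conjI subsetI)
    show "finite (fst H)" using fin by (simp add: H_def)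
    show "x \<in> Y" if "x \<in> fst H" for x using that sub f by (auto simp: H_def)
    fix e' assume "e' \<in> snd H"
    then obtain e where e: "e \<in> E" "e' = f ` e" by (auto simp: H_def)
    obtain v w where vw: "e = {v, w}" "v \<in> fst G" "w \<in> fst G"
      using edge[of e] e(1) unfolding E_def by blast
    then show "e' \<in> {{v, w} | v w. v \<in> fst H \<and> w \<in> fst H \<and> v \<noteq> w}"
      using e E_iff by (auto simp: H_def)
  qed
  have "(f v, f w) \<in> {(x, y). {x, y} \<in> snd H}\<^sup>*" if "(v, w) \<in> {(x, y). {x, y} \<in> snd G}\<^sup>*" for v w
    using that
  proof induction
    case (step y z)
    show ?case
    proof (cases "f y = f z")
      case True
      then show ?thesis using step.IH by simp
    next
      case False
      then have "{y, z} \<in> E" using step.hyps E_iff by simp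
      then have "f ` {y, z} \<in> snd H" unfolding H_def by (metis image_eqI snd_conv)
      then show ?thesis using step.IH by (auto intro: rtrancl_into_rtrancl)
    qed
  qed simp
  then have conH: "graph_connected H"
    using G(2) by (auto simp: graph_connected_def H_def)
  have "graph_length d' H \<le> (\<Sum>e\<in>E. edge_length d' (f ` e))"
    unfolding graph_length_def H_def snd_conv
  proof (rule order_trans[OF sum_image_le])
    show "finite E" using graph_on_finite_edges[OF G(1)] by (simp add: E_def)
    show "0 \<le> edge_length d' (f ` e)" if "e \<in> E" for e
      using edge_length_nonneg[OF onH _ comm(2) nonneg(2)] that by (simp add: H_def)
  qed simp
  also have "\<dots> \<le> (\<Sum>e\<in>E. edge_length d e)"
  proof (rule sum_mono)
    fix e assume e: "e \<in> E"
    obtain v w where "e = {v, w}" "v \<in> fst G" "w \<in> fst G"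
      using edge[of e] e unfolding E_def by blast
    then show "edge_length d' (f ` e) \<le> edge_length d e"
      using lip sub by (auto simp: edge_length_pair comm)
  qed
  also have "\<dots> \<le> graph_length d G"
    unfolding graph_length_def using graph_on_finite_edges[OF G(1)]
    by (intro sum_mono2) (auto simp: E_def intro: edge_length_nonneg[OF G(1) _ comm(1) nonneg(1)])
  finally show ?thesis
    using onH conH by (intro exI[of _ H]) (simp add: H_def)
qed

text \<open>
  In both directions connected graphs are transported by 1-Lipschitz maps that fix the points of
  \<open>M\<close>.  A graph in the given space goes to the space \<open>real^'n\<close> with the supremum
  norm, along an extension of \<open>\<sigma>\<close>, and there it is a filling of \<open>M\<close>.  A graph in any filling goes
  to \<open>real^'n\<close> along an extension of \<open>\<sigma>\<close>, and then back to the given space along \<open>\<tau>\<close>.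
\<close>
lemma smt_length_eq_mf_length:
  fixes d :: "'a \<Rightarrow> 'a \<Rightarrow> real" and \<sigma> :: "'a \<Rightarrow> real^'n" and \<tau> :: "real^'n \<Rightarrow> 'a"
  assumes M: "finite M" "M \<noteq> {}"
    and self: "\<And>x. d x x = 0" and comm: "\<And>x y. d x y = d y x"
    and tri: "\<And>x y z. d x z \<le> d x y + d y z"
    and \<sigma>: "\<And>x y. x \<in> M \<Longrightarrow> y \<in> M \<Longrightarrow> infnorm (\<sigma> x - \<sigma> y) = d x y"
    and \<tau>: "\<And>u v. d (\<tau> u) (\<tau> v) \<le> infnorm (u - v)"
    and retract: "\<And>x. x \<in> M \<Longrightarrow> \<tau> (\<sigma> x) = x"
  shows "smt_length UNIV d M = mf_length M d"
proof (rule antisym)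
  have nonneg: "0 \<le> d x y" for x y
    using tri[of x x y] self[of x] comm[of x y] by simp
  let ?dist = "\<lambda>u v :: real^'n. infnorm (u - v)"
  let ?L = "metric (UNIV, ?dist)"
  interpret L: Metric_space UNIV ?dist by (rule Metric_space_infnorm)
  have L: "mspace ?L = UNIV" "mdist ?L = ?dist" by (simp_all add: L.mspace_metric L.mdist_metric)
  have emb: "isometric_embedding M d ?L \<sigma>"
    using \<sigma> by (simp add: isometric_embedding_def L)
  show "mf_length M d \<le> smt_length UNIV d M"
    unfolding smt_length_def
  proof (rule cInf_greatest)
    show "{graph_length d G |G. graph_on UNIV G \<and> graph_connected G \<and> M \<subseteq> fst G} \<noteq> {}"
      using connected_graph_exists[OF M(1), of UNIV] by blast
    fix l assume "l \<in> {graph_length d G |G. graph_on UNIV G \<and> graph_connected G \<and> M \<subseteq> fst G}"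
    then obtain G where G: "l = graph_length d G" "graph_on UNIV G" "graph_connected G" "M \<subseteq> fst G"
      by blast
    have "\<exists>F. (\<forall>x\<in>UNIV. \<forall>y\<in>UNIV. infnorm (F x - F y) \<le> d x y) \<and> (\<forall>x\<in>M. F x = \<sigma> x)"
      by (rule lipschitz_extension_infnorm[OF M]) (simp_all add: self comm tri \<sigma>)
    then obtain F where F: "\<And>x y. infnorm (F x - F y) \<le> d x y" "\<And>x. x \<in> M \<Longrightarrow> F x = \<sigma> x"
      by blast
    have "\<exists>H. graph_on UNIV H \<and> graph_connected H \<and> fst H = F ` fst G \<and>
      graph_length ?dist H \<le> graph_length d G"
      by (rule lipschitz_graph_image[OF G(2,3)])
        (simp_all add: comm nonneg F infnorm_sub infnorm_pos_le)
    then obtain H where H: "graph_on UNIV H" "graph_connected H" "fst H = F ` fst G"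
      "graph_length ?dist H \<le> graph_length d G" by blast
    have "\<sigma> ` M \<subseteq> fst H" using H(3) F(2) G(4) by force
    then have "smt_length UNIV ?dist (\<sigma> ` M) \<le> graph_length ?dist H"
      using smt_length_le[of ?L H "\<sigma> ` M"] H(1,2) by (simp add: L)
    then show "mf_length M d \<le> l"
      using mf_length_le[OF M(1) emb] H(4) G(1) by (simp add: L)
  qed
  show "smt_length UNIV d M \<le> mf_length M d"
    unfolding mf_length_def
  proof (rule cInf_greatest)
    let ?K = "submetric ?L (\<sigma> ` M)"
    have K: "mspace ?K = \<sigma> ` M" "mdist ?K = ?dist" by (simp_all add: L)
    then have "compact_space (mtopology_of ?K)"
      using M(1) by (intro compact_space_finite) simp
    then obtain Y :: "real metric" and f where f: "isometry ?K Y f"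
      using compact_isometric_real unfolding isometric_def by blast
    then have "isometric_embedding M d Y (f \<circ> \<sigma>)"
      using emb K unfolding isometric_embedding_def isometry_def bij_betw_def by (auto simp: L)
    then show "{r. \<exists>(X :: real metric) \<mu>. isometric_embedding M d X \<mu> \<and>
        smt_length (mspace X) (mdist X) (\<mu> ` M) \<le> r} \<noteq> {}" by blast
    fix r assume "r \<in> {r. \<exists>(X :: real metric) \<mu>. isometric_embedding M d X \<mu> \<and>
        smt_length (mspace X) (mdist X) (\<mu> ` M) \<le> r}"
    then obtain X :: "real metric" and \<mu> where \<mu>: "isometric_embedding M d X \<mu>"
      and r: "smt_length (mspace X) (mdist X) (\<mu> ` M) \<le> r" by blast
    have \<mu>X: "\<mu> ` M \<subseteq> mspace X" using \<mu> by (simp add: isometric_embedding_def)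
    have "\<exists>F. (\<forall>x\<in>mspace X. \<forall>y\<in>mspace X. infnorm (F x - F y) \<le> mdist X x y) \<and> (\<forall>x\<in>M. F (\<mu> x) = \<sigma> x)"
      using \<mu> by (intro lipschitz_extension_infnorm[OF M])
        (auto simp: isometric_embedding_def \<sigma> mdist_commute intro: mdist_triangle)
    then obtain F where F: "\<And>x y. x \<in> mspace X \<Longrightarrow> y \<in> mspace X \<Longrightarrow> infnorm (F x - F y) \<le> mdist X x y"
      "\<And>x. x \<in> M \<Longrightarrow> F (\<mu> x) = \<sigma> x"
      by blast
    have "smt_length UNIV d M \<le> smt_length (mspace X) (mdist X) (\<mu> ` M)"
      unfolding smt_length_def[of "mspace X"]
    proof (rule cInf_greatest)
      show "{graph_length (mdist X) G |G. graph_on (mspace X) G \<and> graph_connected G \<and> \<mu> ` M \<subseteq> fst G} \<noteq> {}"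
        using connected_graph_exists[OF finite_imageI[OF M(1)] \<mu>X] by blast
      fix l assume "l \<in> {graph_length (mdist X) G |G. graph_on (mspace X) G \<and> graph_connected G \<and> \<mu> ` M \<subseteq> fst G}"
      then obtain G where G: "l = graph_length (mdist X) G" "graph_on (mspace X) G"
        "graph_connected G" "\<mu> ` M \<subseteq> fst G" by blast
      have "\<exists>H. graph_on UNIV H \<and> graph_connected H \<and> fst H = (\<lambda>x. \<tau> (F x)) ` fst G \<and>
        graph_length d H \<le> graph_length (mdist X) G"
        by (rule lipschitz_graph_image[OF G(2,3)])
          (auto simp: mdist_commute comm nonneg intro: order_trans[OF \<tau> F(1)])
      then obtain H where H: "graph_on UNIV H" "graph_connected H" "fst H = (\<lambda>x. \<tau> (F x)) ` fst G"
        "graph_length d H \<le> graph_length (mdist X) G" by blast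
      have "M \<subseteq> fst H"
      proof
        fix x assume x: "x \<in> M"
        then have "\<tau> (F (\<mu> x)) = x" using F(2) retract by simp
        then show "x \<in> fst H" using x G(4) H(3) by (metis image_eqI image_subset_iff)
      qed
      then have "smt_length UNIV d M \<le> graph_length d H"
        unfolding smt_length_def
      proof (intro cInf_lower bdd_belowI[of _ 0])
        show "graph_length d H \<in> {graph_length d G |G. graph_on UNIV G \<and> graph_connected G \<and> M \<subseteq> fst G}"
          using H(1,2) \<open>M \<subseteq> fst H\<close> by blast
        show "0 \<le> a" if "a \<in> {graph_length d G |G. graph_on UNIV G \<and> graph_connected G \<and> M \<subseteq> fst G}" for a
          using that edge_length_nonneg[OF _ _ comm nonneg] unfolding graph_length_def
          by (auto intro!: sum_nonneg)
      qed
      then show "smt_length UNIV d M \<le> l" using H(4) G(1) by simp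
    qed
    then show "smt_length UNIV d M \<le> r" using r by simp
  qed
qed



section \<open>Triangles\<close>

lemma UNIV_3: "(UNIV :: 3 set) = {0, 1, 2}"
  using exhaust_3 by force

lemma all_3: "(\<forall>i :: 3. P i) \<longleftrightarrow> P 0 \<and> P 1 \<and> P 2"
proof -
  have "(\<forall>i :: 3. P i) \<longleftrightarrow> (\<forall>i \<in> {0, 1, 2}. P i)" unfolding UNIV_3[symmetric] by simp
  then show ?thesis by simp
qed

lemma uminus_3: "- 1 = (2 :: 3)" "- 2 = (1 :: 3)" "- 3 = (0 :: 3)"
  by simp_all

text \<open>
  Triangles are coordinatized by half their side lengths, because half a difference of sides is a
  Gromov--Hausdorff distance.  The coordinate \<open>u $ k\<close> belongs to the side opposite to the vertex
  \<open>k\<close>.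
\<close>
definition triangle_condition :: "real^3 \<Rightarrow> bool" where
  "triangle_condition u \<longleftrightarrow> (\<forall>i. 0 < u $ i) \<and>
     u $ 0 \<le> u $ 1 + u $ 2 \<and> u $ 1 \<le> u $ 0 + u $ 2 \<and> u $ 2 \<le> u $ 0 + u $ 1"

text \<open>
  Since \<open>0 + 1 + 2 = 0\<close> modulo 3, the vertex other than \<open>i\<close> and \<open>j\<close> is \<open>- (i + j)\<close>.
\<close>
definition triangle :: "real^3 \<Rightarrow> 3 metric" where
  "triangle u = metric (UNIV, \<lambda>i j. if i = j then 0 else 2 * u $ (- (i + j)))"

lemma triangle_space:
  assumes "triangle_condition u"
  shows "mspace (triangle u) = UNIV"
    and "mdist (triangle u) i j = (if i = j then 0 else 2 * u $ (- (i + j)))"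
proof -
  let ?d = "\<lambda>i j :: 3. if i = j then 0 else 2 * u $ (- (i + j))"
  interpret Metric_space UNIV ?d
  proof
    fix i j k :: 3
    show "0 \<le> ?d i j" using assms by (auto simp: triangle_condition_def less_imp_le)
    show "?d i j = ?d j i" by (simp add: add.commute)
    show "(?d i j = 0) = (i = j)" using assms by (auto simp: triangle_condition_def less_le)
    have "\<forall>i j k. ?d i k \<le> ?d i j + ?d j k"
      unfolding all_3 using assms by (simp add: triangle_condition_def all_3 uminus_3)
    then show "?d i k \<le> ?d i j + ?d j k" by blast
  qed
  show "mspace (triangle u) = UNIV"
    and "mdist (triangle u) i j = (if i = j then 0 else 2 * u $ (- (i + j)))"
    by (simp_all add: triangle_def mspace_metric mdist_metric)
qed

definition sorted_sides :: "real^3 \<Rightarrow> bool" where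
  "sorted_sides u \<longleftrightarrow> u $ 0 \<le> u $ 1 \<and> u $ 1 \<le> u $ 2"

lemma isometry_triangleI:
  assumes X: "mspace X = {x0, x1, x2}" "x0 \<noteq> x1" "x1 \<noteq> x2" "x0 \<noteq> x2"
    and u: "mdist X x1 x2 = 2 * u $ 0" "mdist X x0 x2 = 2 * u $ 1" "mdist X x0 x1 = 2 * u $ 2"
  shows "triangle_condition u" "isometric X (triangle u)"
proof -
  have m: "x0 \<in> mspace X" "x1 \<in> mspace X" "x2 \<in> mspace X" using X by auto
  have "0 < mdist X x1 x2" "0 < mdist X x0 x2" "0 < mdist X x0 x1"
    using m X(2-4) by (simp_all add: less_le)
  moreover have "mdist X x1 x2 \<le> mdist X x0 x2 + mdist X x0 x1"
    "mdist X x0 x2 \<le> mdist X x1 x2 + mdist X x0 x1"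
    "mdist X x0 x1 \<le> mdist X x1 x2 + mdist X x0 x2"
    using mdist_triangle[OF m(2,1,3)] mdist_triangle[OF m(1,2,3)] mdist_triangle[OF m(1,3,2)]
    by (simp_all add: mdist_commute)
  ultimately show tc: "triangle_condition u"
    using u by (simp add: triangle_condition_def all_3)
  define f :: "3 \<Rightarrow> 'a" where "f i = (if i = 0 then x0 else if i = 1 then x1 else x2)" for i
  have f: "f 0 = x0" "f 1 = x1" "f 2 = x2" by (simp_all add: f_def)
  have "inj f" unfolding inj_def all_3 using X(2-4) f by auto
  moreover have "range f = mspace X" unfolding UNIV_3 X(1) by (simp add: f)
  ultimately have "bij_betw f UNIV (mspace X)" unfolding bij_betw_def ..
  moreover have "\<forall>i j. mdist X (f i) (f j) = mdist (triangle u) i j"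
    unfolding all_3 using m u by (simp add: f triangle_space[OF tc] mdist_commute uminus_3)
  ultimately have "isometry (triangle u) X f"
    unfolding isometry_def by (simp add: triangle_space[OF tc])
  then show "isometric X (triangle u)"
    using isometric_sym unfolding isometric_def by blast
qed

lemma sorted_triangle_exists:
  assumes "card (mspace X) = 3"
  obtains u where "triangle_condition u" "sorted_sides u" "isometric X (triangle u)"
proof -
  obtain a b c where abc: "mspace X = {a, b, c}" "a \<noteq> b" "b \<noteq> c" "a \<noteq> c"
    using assms card_3_iff by metis
  have com: "mdist X b a = mdist X a b" "mdist X c a = mdist X a c" "mdist X c b = mdist X b c"
    by (rule mdist_commute)+
  have "\<exists>x0 x1 x2. mspace X = {x0, x1, x2} \<and> x0 \<noteq> x1 \<and> x1 \<noteq> x2 \<and> x0 \<noteq> x2 \<and>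
    mdist X x1 x2 \<le> mdist X x0 x2 \<and> mdist X x0 x2 \<le> mdist X x0 x1"
  proof -
    have *: "?thesis" if "mspace X = {x0, x1, x2}" "x0 \<noteq> x1" "x1 \<noteq> x2" "x0 \<noteq> x2"
      "mdist X x1 x2 \<le> mdist X x0 x2" "mdist X x0 x2 \<le> mdist X x0 x1" for x0 x1 x2
      using that by blast
    consider "mdist X b c \<le> mdist X a c" "mdist X a c \<le> mdist X a b"
      | "mdist X b c \<le> mdist X a b" "mdist X a b \<le> mdist X a c"
      | "mdist X a c \<le> mdist X b c" "mdist X b c \<le> mdist X a b"
      | "mdist X a c \<le> mdist X a b" "mdist X a b \<le> mdist X b c"
      | "mdist X a b \<le> mdist X a c" "mdist X a c \<le> mdist X b c"
      | "mdist X a b \<le> mdist X b c" "mdist X b c \<le> mdist X a c"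
      by linarith
    then show ?thesis
    proof cases
      case 1 show ?thesis by (rule *[of a b c]) (use abc(2-4) com 1 in \<open>simp_all add: abc(1) insert_commute\<close>)
    next
      case 2 show ?thesis by (rule *[of a c b]) (use abc(2-4) com 2 in \<open>simp_all add: abc(1) insert_commute\<close>)
    next
      case 3 show ?thesis by (rule *[of b a c]) (use abc(2-4) com 3 in \<open>simp_all add: abc(1) insert_commute\<close>)
    next
      case 4 show ?thesis by (rule *[of b c a]) (use abc(2-4) com 4 in \<open>simp_all add: abc(1) insert_commute\<close>)
    next
      case 5 show ?thesis by (rule *[of c b a]) (use abc(2-4) com 5 in \<open>simp_all add: abc(1) insert_commute\<close>)
    next
      case 6 show ?thesis by (rule *[of c a b]) (use abc(2-4) com 6 in \<open>simp_all add: abc(1) insert_commute\<close>)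
    qed
  qed
  then obtain x0 x1 x2 where x: "mspace X = {x0, x1, x2}" "x0 \<noteq> x1" "x1 \<noteq> x2" "x0 \<noteq> x2"
    "mdist X x1 x2 \<le> mdist X x0 x2" "mdist X x0 x2 \<le> mdist X x0 x1" by blast
  define u :: "real^3" where
    "u = (\<chi> i. if i = 0 then mdist X x1 x2 / 2 else if i = 1 then mdist X x0 x2 / 2 else mdist X x0 x1 / 2)"
  have u: "mdist X x1 x2 = 2 * u $ 0" "mdist X x0 x2 = 2 * u $ 1" "mdist X x0 x1 = 2 * u $ 2"
    by (simp_all add: u_def)
  show thesis
    using isometry_triangleI[OF x(1-4) u] that x(5,6) u by (simp add: sorted_sides_def)
qed

text \<open>
  Sorting is 1-Lipschitz for the supremum norm: if two triples are close after some permutation,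
  they are as close when both are listed in increasing order.
\<close>
lemma sorted_sides_matching:
  fixes f :: "3 \<Rightarrow> 3"
  assumes "bij f" "sorted_sides u" "sorted_sides v" "\<And>k. \<bar>u $ k - v $ f k\<bar> \<le> r"
  shows "\<bar>u $ k - v $ k\<bar> \<le> r"
proof -
  have "f 0 \<noteq> f 1" "f 1 \<noteq> f 2" "f 0 \<noteq> f 2"
    using assms(1) by (simp_all add: bij_def inj_eq)
  moreover have "f 0 \<in> {0, 1, 2}" "f 1 \<in> {0, 1, 2}" "f 2 \<in> {0, 1, 2}"
    using UNIV_3 by blast+
  ultimately consider "f 0 = 0" "f 1 = 1" "f 2 = 2" | "f 0 = 0" "f 1 = 2" "f 2 = 1"
    | "f 0 = 1" "f 1 = 0" "f 2 = 2" | "f 0 = 1" "f 1 = 2" "f 2 = 0"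
    | "f 0 = 2" "f 1 = 0" "f 2 = 1" | "f 0 = 2" "f 1 = 1" "f 2 = 0"
    by (metis insertE emptyE)
  then have "\<forall>k. u $ k - v $ k \<le> r \<and> v $ k - u $ k \<le> r"
    using assms(2,3) unfolding all_3 sorted_sides_def
    by cases (insert assms(4)[of 0, unfolded abs_le_iff] assms(4)[of 1, unfolded abs_le_iff]
        assms(4)[of 2, unfolded abs_le_iff], simp_all only: minus_diff_eq, argo+)
  then show ?thesis by (simp add: abs_le_iff)
qed

text \<open>
  A bijection of the vertices of a triangle acts on the sides in the same way as on the opposite
  vertices.
\<close>
lemma bij_opposite_side:
  fixes f :: "3 \<Rightarrow> 3"
  assumes "bij f" "i \<noteq> j"
  shows "- (f i + f j) = f (- (i + j))"
proof -
  have ne: "f 0 \<noteq> f 1" "f 1 \<noteq> f 2" "f 0 \<noteq> f 2"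
    using assms(1) by (simp_all add: bij_def inj_eq)
  have "f 0 \<in> {0, 1, 2}" "f 1 \<in> {0, 1, 2}" "f 2 \<in> {0, 1, 2}"
    using UNIV_3 by blast+
  then have "\<forall>i j. i \<noteq> j \<longrightarrow> - (f i + f j) = f (- (i + j))"
    unfolding all_3 using ne by (elim insertE emptyE) (simp_all add: uminus_3)
  then show ?thesis using assms(2) by blast
qed

lemma compact_triangle:
  assumes "triangle_condition u"
  shows "mspace (triangle u) \<noteq> {}" "compact_space (mtopology_of (triangle u))"
  using triangle_space(1)[OF assms] compact_space_finite[of "triangle u"] by auto

lemma gh_dist_triangle_le:
  assumes u: "triangle_condition u" and v: "triangle_condition v"
  shows "gh_dist (gh_class (triangle u)) (gh_class (triangle v)) \<le> infnorm (u - v)"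
proof -
  have "\<bar>mdist (triangle u) i j - mdist (triangle v) i j\<bar> \<le> 2 * infnorm (u - v)" for i j
  proof (cases "i = j")
    case True
    then show ?thesis by (simp add: triangle_space[OF u] triangle_space[OF v] infnorm_pos_le)
  next
    case False
    have "\<bar>(u - v) $ (- (i + j))\<bar> \<le> infnorm (u - v)" by (rule component_le_infnorm_cart)
    then show ?thesis using False by (simp add: triangle_space[OF u] triangle_space[OF v])
  qed
  then have "correspondence (triangle u) (triangle v) (2 * infnorm (u - v)) Id"
    by (auto simp: correspondence_def triangle_space(1)[OF u] triangle_space(1)[OF v])
  then show ?thesis
    unfolding gh_dist_gh_class[OF compact_triangle[OF u] compact_triangle[OF v]]
    by (intro gh_distance_le_correspondence compact_triangle u v infnorm_pos_le)
qed

text \<open>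
  A correspondence of distortion smaller than the shortest side is a bijection of the vertices.
  It matches the sides by some permutation, which sorting makes the identity.
\<close>
lemma infnorm_le_gh_dist_triangle:
  assumes u: "triangle_condition u" "sorted_sides u" and v: "triangle_condition v" "sorted_sides v"
    and less: "gh_dist (gh_class (triangle u)) (gh_class (triangle v)) < u $ 0"
  shows "infnorm (u - v) \<le> gh_dist (gh_class (triangle u)) (gh_class (triangle v))"
proof (rule dense_ge_bounded[OF less])
  fix r assume r: "gh_dist (gh_class (triangle u)) (gh_class (triangle v)) < r" "r < u $ 0"
  obtain R where R: "correspondence (triangle u) (triangle v) (2 * r) R"
    using correspondence_of_gh_distance_less[OF compact_triangle[OF u(1)] compact_triangle[OF v(1)]]
      gh_dist_gh_class[OF compact_triangle[OF u(1)] compact_triangle[OF v(1)]] r(1) by auto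
  have "\<forall>i. r < u $ i"
    unfolding all_3 using u(2) r(2) by (simp add: sorted_sides_def)
  then obtain f where f: "bij f"
    "\<And>i j. \<bar>mdist (triangle u) i j - mdist (triangle v) (f i) (f j)\<bar> \<le> 2 * r"
    using correspondence_bijection[OF R] by (auto simp: triangle_space[OF u(1)] triangle_space[OF v(1)])
  have side: "\<bar>u $ (- (i + j)) - v $ f (- (i + j))\<bar> \<le> r" if "i \<noteq> j" for i j
  proof -
    have "f i \<noteq> f j" using f(1) that by (simp add: bij_def inj_eq)
    then show ?thesis
      using f(2)[of i j] that bij_opposite_side[OF f(1) that]
      by (simp add: triangle_space[OF u(1)] triangle_space[OF v(1)])
  qed
  have "\<forall>k. \<bar>u $ k - v $ f k\<bar> \<le> r"
    unfolding all_3 using side[of 1 2] side[of 0 2] side[of 0 1] by (simp add: uminus_3)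
  then have "\<bar>u $ k - v $ k\<bar> \<le> r" for k
    using sorted_sides_matching[OF f(1) u(2) v(2)] by blast
  then show "infnorm (u - v) \<le> r" by (simp add: infnorm_le_cart)
qed

lemma card_mspace_near_triangle:
  assumes X: "mspace X \<noteq> {}" "finite (mspace X)" "card (mspace X) \<le> 3"
    and t: "triangle_condition t" "sorted_sides t"
    and less: "gh_dist (gh_class X) (gh_class (triangle t)) < t $ 0"
  shows "card (mspace X) = 3"
proof -
  note cX = X(1) compact_space_finite[OF X(2)]
  note ct = compact_triangle[OF t(1)]
  have "gh_distance (triangle t) X < t $ 0"
    using less gh_dist_gh_class[OF ct cX] gh_dist_commute by metis
  then obtain r where r: "gh_distance (triangle t) X < r" "r < t $ 0" using dense by blast
  obtain R where R: "correspondence (triangle t) X (2 * r) R"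
    using correspondence_of_gh_distance_less[OF ct cX r(1)] by blast
  have "\<forall>i. r < t $ i"
    unfolding all_3 using t(2) r(2) by (simp add: sorted_sides_def)
  then have "\<exists>f. bij_betw f (mspace (triangle t)) (mspace X)"
    using correspondence_bijection[OF R _ X(2)] X(3) by (auto simp: triangle_space[OF t(1)])
  then show ?thesis using bij_betw_same_card by (fastforce simp: triangle_space[OF t(1)])
qed

text \<open>
  A nearest-point retraction onto a cube; it is 1-Lipschitz for the supremum norm, as
  a coordinatewise truncation.
\<close>
definition clamp_sides :: "real \<Rightarrow> real^3 \<Rightarrow> real^3 \<Rightarrow> real^3" where
  "clamp_sides \<epsilon> t u = (\<chi> k. max (t $ k - \<epsilon>) (min (t $ k + \<epsilon>) (u $ k)))"

text \<open>
  The quantity \<open>t $ 0 + t $ 1 - t $ 2\<close> is the slack of the tightest triangle inequality of a sorted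
  triangle; changing three sides by \<open>\<epsilon>\<close> uses up at most \<open>3 * \<epsilon>\<close> of it.
\<close>
lemma triangle_condition_near:
  assumes t: "triangle_condition t" "sorted_sides t"
    and \<epsilon>: "4 * \<epsilon> \<le> t $ 0" "4 * \<epsilon> \<le> t $ 0 + t $ 1 - t $ 2" "0 < \<epsilon>"
    and u: "infnorm (u - t) \<le> \<epsilon>"
  shows "triangle_condition u"
proof -
  have "\<bar>u $ k - t $ k\<bar> \<le> \<epsilon>" for k
    using u by (simp add: infnorm_le_cart)
  from this[of 0] this[of 1] this[of 2] show ?thesis
    using t \<epsilon> unfolding triangle_condition_def sorted_sides_def all_3 abs_le_iff minus_diff_eq
    by argo
qed

lemma infnorm_clamp_sides: "infnorm (clamp_sides \<epsilon> t u - clamp_sides \<epsilon> t v) \<le> infnorm (u - v)"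
  unfolding infnorm_le_cart
proof
  fix k
  have "\<bar>(u - v) $ k\<bar> \<le> infnorm (u - v)" by (rule component_le_infnorm_cart)
  then show "\<bar>(clamp_sides \<epsilon> t u - clamp_sides \<epsilon> t v) $ k\<bar> \<le> infnorm (u - v)"
    by (simp add: clamp_sides_def max_def min_def abs_le_iff)
qed

lemma infnorm_clamp_sides_le:
  assumes "0 \<le> \<epsilon>"
  shows "infnorm (clamp_sides \<epsilon> t u - t) \<le> \<epsilon>"
  unfolding infnorm_le_cart using assms by (simp add: clamp_sides_def max_def min_def abs_le_iff)

lemma clamp_sides_eq:
  assumes "infnorm (u - t) \<le> \<epsilon>"
  shows "clamp_sides \<epsilon> t u = u"
  unfolding vec_eq_iff
proof
  fix k
  have "\<bar>u $ k - t $ k\<bar> \<le> \<epsilon>" using assms by (simp add: infnorm_le_cart)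
  then show "clamp_sides \<epsilon> t u $ k = u $ k"
    by (simp add: clamp_sides_def abs_le_iff)
qed

section \<open>Steiner minimal trees near a nondegenerate triangle\<close>

theorem theorem3:
  fixes T :: "'a metric"
  assumes "card (mspace T) = 3"
    and "\<And>x y z. x \<in> mspace T \<Longrightarrow> y \<in> mspace T \<Longrightarrow> z \<in> mspace T \<Longrightarrow>
           x \<noteq> y \<Longrightarrow> y \<noteq> z \<Longrightarrow> x \<noteq> z \<Longrightarrow> mdist T x z < mdist T x y + mdist T y z"
  shows "\<exists>\<epsilon>>0. \<forall>M. M \<noteq> {} \<and> finite M \<and> M \<subseteq> gh_nbhd3 \<epsilon> (gh_class T) \<longrightarrow>
           (\<forall>G \<in> steiner_minimal_trees UNIV gh_dist M. minimal_filling M G)"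
proof -
  have finT: "finite (mspace T)" and neT: "mspace T \<noteq> {}"
    using assms(1) card.infinite by fastforce+
  obtain t where t: "triangle_condition t" "sorted_sides t" "isometric T (triangle t)"
    using sorted_triangle_exists[OF assms(1)] by blast
  have T: "gh_class T = gh_class (triangle t)"
    using gh_class_eq_iff[OF neT compact_space_finite[OF finT] compact_triangle[OF t(1)]] t(3) by simp
  \<comment> \<open>The vertex 2 lies opposite to the longest side, which joins the vertices 0 and 1.\<close>
  have strict: "t $ 2 < t $ 0 + t $ 1"
  proof -
    obtain h where h: "isometry (triangle t) T h"
      using isometric_sym[OF t(3)] unfolding isometric_def by blast
    have "h i \<in> mspace T" and d: "mdist T (h i) (h j) = mdist (triangle t) i j" and "h i = h j \<longleftrightarrow> i = j" for i j
      using h unfolding isometry_def bij_betw_def triangle_space(1)[OF t(1)] by (auto simp: inj_eq)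
    then have "mdist T (h 0) (h 1) < mdist T (h 0) (h 2) + mdist T (h 2) (h 1)"
      by (intro assms(2)) auto
    then show ?thesis
      by (simp add: d triangle_space(2)[OF t(1)] uminus_3)
  qed
  \<comment> \<open>With the factor 1/4, the triples in the cube of radius \<open>\<epsilon>\<close> about \<open>t\<close> are triangles,
    and their coordinates are at least \<open>3 * \<epsilon>\<close>, more than the diameter of the cube.\<close>
  define \<epsilon> where "\<epsilon> = min (t $ 0) (t $ 0 + t $ 1 - t $ 2) / 4"
  have \<epsilon>: "4 * \<epsilon> \<le> t $ 0" "4 * \<epsilon> \<le> t $ 0 + t $ 1 - t $ 2" "0 < \<epsilon>"
    using strict t(1) by (auto simp: \<epsilon>_def triangle_condition_def)
  note near = triangle_condition_near[OF t(1,2) \<epsilon>]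
  define \<tau> where "\<tau> u = gh_class (triangle (clamp_sides \<epsilon> t u))" for u
  have \<tau>: "gh_dist (\<tau> u) (\<tau> v) \<le> infnorm (u - v)" for u v
    unfolding \<tau>_def
    using gh_dist_triangle_le[OF near near, of "clamp_sides \<epsilon> t u" "clamp_sides \<epsilon> t v"]
      infnorm_clamp_sides_le[of \<epsilon> t] infnorm_clamp_sides[of \<epsilon> t u v] \<epsilon>(3) by fastforce
  have "\<exists>u. sorted_sides u \<and> infnorm (u - t) \<le> \<epsilon> \<and> gh_class (triangle u) = p"
    if p: "p \<in> gh_nbhd3 \<epsilon> (gh_class T)" for p
  proof -
    obtain X :: "real metric" where X: "p = gh_class X" "mspace X \<noteq> {}" "finite (mspace X)"
      "card (mspace X) \<le> 3" and d: "gh_dist p (gh_class T) < \<epsilon>"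
      using p unfolding gh_nbhd3_def gh_points_le_def by blast
    have "card (mspace X) = 3"
      using card_mspace_near_triangle[OF X(2-4) t(1,2)] d T X(1) \<epsilon>(1,3) by simp
    then obtain u where u: "triangle_condition u" "sorted_sides u" "isometric X (triangle u)"
      using sorted_triangle_exists by blast
    have p: "gh_class (triangle u) = p"
      using gh_class_eq_iff[OF X(2) compact_space_finite[OF X(3)] compact_triangle[OF u(1)]] u(3) X(1)
      by simp
    have "infnorm (t - u) \<le> gh_dist (gh_class (triangle t)) (gh_class (triangle u))"
      using infnorm_le_gh_dist_triangle[OF t(1,2) u(1,2)] d T p \<epsilon>(1,3)
      by (simp add: gh_dist_commute)
    then have "infnorm (u - t) \<le> \<epsilon>"
      using d T p by (simp add: gh_dist_commute infnorm_sub)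
    then show ?thesis using u(2) p by blast
  qed
  then obtain \<sigma> where \<sigma>: "\<And>p. p \<in> gh_nbhd3 \<epsilon> (gh_class T) \<Longrightarrow> sorted_sides (\<sigma> p) \<and> infnorm (\<sigma> p - t) \<le> \<epsilon> \<and>
      gh_class (triangle (\<sigma> p)) = p" by metis
  have \<sigma>_dist: "infnorm (\<sigma> p - \<sigma> q) = gh_dist p q"
    if p: "p \<in> gh_nbhd3 \<epsilon> (gh_class T)" and q: "q \<in> gh_nbhd3 \<epsilon> (gh_class T)" for p q
  proof (rule antisym)
    have tri: "triangle_condition (\<sigma> p)" "triangle_condition (\<sigma> q)" using \<sigma> p q near by blast+
    show "gh_dist p q \<le> infnorm (\<sigma> p - \<sigma> q)"
      using gh_dist_triangle_le[OF tri] \<sigma> p q by simp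
    have "gh_dist p q < 2 * \<epsilon>"
      using gh_dist_triangle[of p q "gh_class T"] gh_dist_commute[of q] p q
      by (simp add: gh_nbhd3_def)
    moreover have "\<bar>\<sigma> p $ 0 - t $ 0\<bar> \<le> \<epsilon>" using \<sigma>[OF p] by (simp add: infnorm_le_cart)
    ultimately have "gh_dist p q < \<sigma> p $ 0" using \<epsilon>(1,3) by linarith
    then show "infnorm (\<sigma> p - \<sigma> q) \<le> gh_dist p q"
      using infnorm_le_gh_dist_triangle[OF tri(1) _ tri(2)] \<sigma>[OF p] \<sigma>[OF q] by simp
  qed
  have "smt_length UNIV gh_dist M = mf_length M gh_dist"
    if M: "M \<noteq> {}" "finite M" "M \<subseteq> gh_nbhd3 \<epsilon> (gh_class T)" for M
  proof (rule smt_length_eq_mf_length[OF M(2,1) gh_dist_self gh_dist_commute gh_dist_triangle _ \<tau>])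
    show "infnorm (\<sigma> p - \<sigma> q) = gh_dist p q" if "p \<in> M" "q \<in> M" for p q
      using \<sigma>_dist M(3) that by blast
    show "\<tau> (\<sigma> p) = p" if "p \<in> M" for p
      using \<sigma>[of p] M(3) that clamp_sides_eq[of "\<sigma> p" t \<epsilon>] by (auto simp: \<tau>_def)
  qed
  then have "minimal_filling M G"
    if "M \<noteq> {} \<and> finite M \<and> M \<subseteq> gh_nbhd3 \<epsilon> (gh_class T)" "G \<in> steiner_minimal_trees UNIV gh_dist M" for M G
    using that by (auto simp: minimal_filling_def steiner_minimal_trees_def)
  then show ?thesis using \<epsilon>(3) by blast
qed

end
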